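(* Let $R$ be an indecomposable right artinian right nonsingular right weak CS right $a$-ring. Then there exist positive integers $k,n_1,\dots,n_k$ and idempotents $e_1,\dots,e_k\in R$ such that $R$ is isomorphic, as a ring, to the ring of block upper triangular matrices $$\begin{pmatrix} \mathbb{M}_{n_1}(e_1Re_1)&\mathbb{M}_{n_1\times n_2}(e_1Re_2)&\mathbb{M}_{n_1\times n_3}(e_1Re_3)&\cdots&\mathbb{M}_{n_1\times n_k}(e_1Re_k)\\ 0&\mathbb{M}_{n_2}(e_2Re_2)&\mathbb{M}_{n_2\times n_3}(e_2Re_3)&\cdots&\mathbb{M}_{n_2\times n_k}(e_2Re_k)\\ 0&0&\mathbb{M}_{n_3}(e_3Re_3)&\cdots&\mathbb{M}_{n_3\times n_k}(e_3Re_k)\\ \vdots&\vdots&\vdots&\ddots&\vdots\\ 0&0&0&\cdots&\mathbb{M}_{n_k}(e_kRe_k)\end{pmatrix},$$ where each $e_iRe_i$ is a division ring and $e_iRe_i\cong e_jRe_j$ as rings for all $1\le i,j\le k$. Furthermore, whenever $e_iRe_j\neq 0$, $$\dim({}_{e_iRe_i}(e_iRe_j))=1=\dim((e_iRe_j)_{e_jRe_j}).$$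
   Context: Rings are associative with identity; modules are right unital. A ring is indecomposable if it is not a direct product of two nonzero rings. A right module $M$ is automorphism-invariant if $\varphi(M)\subseteq M$ for every automorphism $\varphi$ of its injective envelope $E(M)$; a ring is a right $a$-ring if every right ideal is automorphism-invariant as a right module. A module $M$ is weak CS if every semisimple submodule of $M$ is essential in a direct summand of $M$; $R$ is right weak CS if $R_R$ is weak CS. $R$ is right nonsingular if $Z(R_R)=0$, where $Z(R_R)$ is the set of elements of $R$ whose right annihilator is an essential right ideal. $\mathbb{M}_{p\times q}(e_iRe_j)$ denotes the $p\times q$ matrices with entries in $e_iRe_j$, $\mathbb{M}_p=\mathbb{M}_{p\times p}$, and multiplication in the block matrix ring is block matrix multiplication induced by the multiplication of $R$. *)

theory Defs
  imports "HOL-Algebra.Algebra"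
begin

section \<open>Right modules over arbitrary rings\<close>

text \<open>
  The library's \<open>module\<close> locale assumes a commutative ring of scalars, so unital right modules
  over a possibly noncommutative ring are introduced here.  As in the library, the record extends
  \<open>ring\<close> only in order to reuse the notions for abelian groups: the inherited
  fields \<open>mult\<close> and \<open>one\<close> of a module are ignored.
\<close>

record ('a, 'm) rmodule = "'m ring" +
  ract :: "'m \<Rightarrow> 'a \<Rightarrow> 'm" (infixl \<open>\<triangleleft>\<index>\<close> 70)

locale right_module = R?: ring R + M?: abelian_group M
  for R :: "('a, 'r) ring_scheme" (structure) and M :: "('a, 'm, 'x) rmodule_scheme" (structure) +
  assumes ract_closed: "\<lbrakk>x \<in> carrier M; a \<in> carrier R\<rbrakk> \<Longrightarrow> x \<triangleleft>\<^bsub>M\<^esub> a \<in> carrier M"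
    and ract_add_left: "\<lbrakk>x \<in> carrier M; y \<in> carrier M; a \<in> carrier R\<rbrakk>
      \<Longrightarrow> (x \<oplus>\<^bsub>M\<^esub> y) \<triangleleft>\<^bsub>M\<^esub> a = x \<triangleleft>\<^bsub>M\<^esub> a \<oplus>\<^bsub>M\<^esub> y \<triangleleft>\<^bsub>M\<^esub> a"
    and ract_add_right: "\<lbrakk>x \<in> carrier M; a \<in> carrier R; b \<in> carrier R\<rbrakk>
      \<Longrightarrow> x \<triangleleft>\<^bsub>M\<^esub> (a \<oplus>\<^bsub>R\<^esub> b) = x \<triangleleft>\<^bsub>M\<^esub> a \<oplus>\<^bsub>M\<^esub> x \<triangleleft>\<^bsub>M\<^esub> b"
    and ract_assoc: "\<lbrakk>x \<in> carrier M; a \<in> carrier R; b \<in> carrier R\<rbrakk>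
      \<Longrightarrow> x \<triangleleft>\<^bsub>M\<^esub> (a \<otimes>\<^bsub>R\<^esub> b) = (x \<triangleleft>\<^bsub>M\<^esub> a) \<triangleleft>\<^bsub>M\<^esub> b"
    and ract_one: "x \<in> carrier M \<Longrightarrow> x \<triangleleft>\<^bsub>M\<^esub> \<one>\<^bsub>R\<^esub> = x"

definition right_regular :: "('a, 'r) ring_scheme \<Rightarrow> ('a, 'a) rmodule" where
  "right_regular R = \<lparr>carrier = carrier R, monoid.mult = monoid.mult R, monoid.one = monoid.one R,
     ring.zero = ring.zero R, ring.add = ring.add R, ract = monoid.mult R\<rparr>"

text \<open>A submodule \<open>N\<close> of \<open>M\<close> is a set; as a module in its own right it is \<open>M\<lparr>carrier := N\<rparr>\<close>.\<close>

definition rsubmodule :: "('a, 'r) ring_scheme \<Rightarrow> ('a, 'm, 'x) rmodule_scheme \<Rightarrow> 'm set \<Rightarrow> bool" where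
  "rsubmodule R M N \<longleftrightarrow> additive_subgroup N M \<and>
     (\<forall>x\<in>N. \<forall>a\<in>carrier R. x \<triangleleft>\<^bsub>M\<^esub> a \<in> N)"

definition right_ideal :: "('a, 'r) ring_scheme \<Rightarrow> 'a set \<Rightarrow> bool" where
  "right_ideal R I \<longleftrightarrow> rsubmodule R (right_regular R) I"

definition rmodule_hom ::
  "('a, 'r) ring_scheme \<Rightarrow> ('a, 'm, 'x) rmodule_scheme \<Rightarrow> ('a, 'n, 'y) rmodule_scheme \<Rightarrow> ('m \<Rightarrow> 'n) set" where
  "rmodule_hom R M N = {h \<in> carrier M \<rightarrow> carrier N.
     (\<forall>x\<in>carrier M. \<forall>y\<in>carrier M. h (x \<oplus>\<^bsub>M\<^esub> y) = h x \<oplus>\<^bsub>N\<^esub> h y) \<and>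
     (\<forall>x\<in>carrier M. \<forall>a\<in>carrier R. h (x \<triangleleft>\<^bsub>M\<^esub> a) = h x \<triangleleft>\<^bsub>N\<^esub> a)}"

definition rmodule_aut :: "('a, 'r) ring_scheme \<Rightarrow> ('a, 'm, 'x) rmodule_scheme \<Rightarrow> ('m \<Rightarrow> 'm) set" where
  "rmodule_aut R M = {h \<in> rmodule_hom R M M. bij_betw h (carrier M) (carrier M)}"

definition essential_in :: "('a, 'r) ring_scheme \<Rightarrow> ('a, 'm, 'x) rmodule_scheme \<Rightarrow> 'm set \<Rightarrow> bool" where
  "essential_in R M N \<longleftrightarrow> rsubmodule R M N \<and>
     (\<forall>K. rsubmodule R M K \<and> K \<noteq> {\<zero>\<^bsub>M\<^esub>} \<longrightarrow> N \<inter> K \<noteq> {\<zero>\<^bsub>M\<^esub>})"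

definition direct_summand :: "('a, 'r) ring_scheme \<Rightarrow> ('a, 'm, 'x) rmodule_scheme \<Rightarrow> 'm set \<Rightarrow> bool" where
  "direct_summand R M K \<longleftrightarrow> rsubmodule R M K \<and>
     (\<exists>L. rsubmodule R M L \<and> K \<inter> L = {\<zero>\<^bsub>M\<^esub>} \<and> K <+>\<^bsub>M\<^esub> L = carrier M)"

definition semisimple_rmodule :: "('a, 'r) ring_scheme \<Rightarrow> ('a, 'm, 'x) rmodule_scheme \<Rightarrow> bool" where
  "semisimple_rmodule R M \<longleftrightarrow> right_module R M \<and> (\<forall>N. rsubmodule R M N \<longrightarrow> direct_summand R M N)"

section \<open>Injective envelopes and automorphism-invariant modules\<close>

text \<open>
  HOL cannot quantify over all modules on all types, so the test modules \<open>A\<close> and \<open>B\<close> range over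
  those whose elements have type \<open>'a + 'e\<close>.  This universe contains a copy of every right ideal
  of \<open>R\<close> and of every submodule of \<open>E\<close>; by Baer's criterion, already the right ideals of \<open>R\<close>
  suffice to make the notion independent of the choice of the universe.
\<close>

definition injective_rmodule :: "('a, 'r) ring_scheme \<Rightarrow> ('a, 'e, 'x) rmodule_scheme \<Rightarrow> bool" where
  "injective_rmodule R E \<longleftrightarrow> right_module R E \<and>
     (\<forall>(A :: ('a, 'a + 'e) rmodule) (B :: ('a, 'a + 'e) rmodule) g h.
        right_module R A \<and> right_module R B \<and>
        g \<in> rmodule_hom R A B \<and> inj_on g (carrier A) \<and> h \<in> rmodule_hom R A E \<longrightarrow>
        (\<exists>h' \<in> rmodule_hom R B E. \<forall>x\<in>carrier A. h' (g x) = h x))"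

definition injective_envelope ::
  "('a, 'r) ring_scheme \<Rightarrow> ('a, 'm, 'x) rmodule_scheme \<Rightarrow> ('a, 'e, 'y) rmodule_scheme \<Rightarrow> ('m \<Rightarrow> 'e) \<Rightarrow> bool" where
  "injective_envelope R M E \<iota> \<longleftrightarrow> injective_rmodule R E \<and>
     \<iota> \<in> rmodule_hom R M E \<and> inj_on \<iota> (carrier M) \<and> essential_in R E (\<iota> ` carrier M)"

text \<open>
  An injective envelope of \<open>M\<close> is unique up to an isomorphism over \<open>M\<close>, so it does not matter
  which one is used to test invariance.  It may need a larger type than \<open>M\<close>;
  the type \<open>'e\<close> of its elements is a parameter.  A statement that holds for
  every \<open>'e\<close> therefore covers every module that is automorphism-invariant with respect to an
  injective envelope of whatever size.
\<close>

definition automorphism_invariant ::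
  "'e itself \<Rightarrow> ('a, 'r) ring_scheme \<Rightarrow> ('a, 'm, 'x) rmodule_scheme \<Rightarrow> bool" where
  "automorphism_invariant (_ :: 'e itself) R M \<longleftrightarrow> right_module R M \<and>
     (\<exists>(E :: ('a, 'e) rmodule) \<iota>. injective_envelope R M E \<iota> \<and>
        (\<forall>\<phi> \<in> rmodule_aut R E. \<phi> ` (\<iota> ` carrier M) \<subseteq> \<iota> ` carrier M))"

definition right_a_ring :: "'e itself \<Rightarrow> ('a, 'r) ring_scheme \<Rightarrow> bool" where
  "right_a_ring T R \<longleftrightarrow> ring R \<and>
     (\<forall>I. right_ideal R I \<longrightarrow> automorphism_invariant T R ((right_regular R)\<lparr>carrier := I\<rparr>))"

section \<open>Conditions on rings\<close>

definition weak_CS :: "('a, 'r) ring_scheme \<Rightarrow> ('a, 'm, 'x) rmodule_scheme \<Rightarrow> bool" where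
  "weak_CS R M \<longleftrightarrow> right_module R M \<and>
     (\<forall>N. rsubmodule R M N \<and> semisimple_rmodule R (M\<lparr>carrier := N\<rparr>) \<longrightarrow>
        (\<exists>K. direct_summand R M K \<and> N \<subseteq> K \<and> essential_in R (M\<lparr>carrier := K\<rparr>) N))"

definition right_weak_CS :: "('a, 'r) ring_scheme \<Rightarrow> bool" where
  "right_weak_CS R \<longleftrightarrow> ring R \<and> weak_CS R (right_regular R)"

definition right_artinian :: "('a, 'r) ring_scheme \<Rightarrow> bool" where
  "right_artinian R \<longleftrightarrow> ring R \<and>
     (\<forall>I :: nat \<Rightarrow> 'a set. (\<forall>m. right_ideal R (I m) \<and> I (Suc m) \<subseteq> I m) \<longrightarrow>
        (\<exists>N. \<forall>m\<ge>N. I m = I N))"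

definition right_annihilator :: "('a, 'r) ring_scheme \<Rightarrow> 'a \<Rightarrow> 'a set" where
  "right_annihilator R x = {a \<in> carrier R. x \<otimes>\<^bsub>R\<^esub> a = \<zero>\<^bsub>R\<^esub>}"

definition right_singular_ideal :: "('a, 'r) ring_scheme \<Rightarrow> 'a set" where
  "right_singular_ideal R =
     {x \<in> carrier R. essential_in R (right_regular R) (right_annihilator R x)}"

definition right_nonsingular :: "('a, 'r) ring_scheme \<Rightarrow> bool" where
  "right_nonsingular R \<longleftrightarrow> ring R \<and> right_singular_ideal R = {\<zero>\<^bsub>R\<^esub>}"

text \<open>The factors of a product decomposition of \<open>R\<close> embed into \<open>R\<close>, so factors on the type
  \<open>'a\<close> suffice.  This condition alone does not exclude the zero ring.\<close>

definition indecomposable_ring :: "('a, 'r) ring_scheme \<Rightarrow> bool" where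
  "indecomposable_ring R \<longleftrightarrow> ring R \<and>
     \<not> (\<exists>(S :: 'a ring) (T :: 'a ring). ring S \<and> ring T \<and>
          carrier S \<noteq> {\<zero>\<^bsub>S\<^esub>} \<and> carrier T \<noteq> {\<zero>\<^bsub>T\<^esub>} \<and> R \<simeq> RDirProd S T)"

definition is_division_ring :: "('a, 'r) ring_scheme \<Rightarrow> bool" where
  "is_division_ring D \<longleftrightarrow> ring D \<and> \<one>\<^bsub>D\<^esub> \<noteq> \<zero>\<^bsub>D\<^esub> \<and> Units D = carrier D - {\<zero>\<^bsub>D\<^esub>}"

section \<open>Peirce components and their dimensions\<close>

definition peirce :: "('a, 'r) ring_scheme \<Rightarrow> 'a \<Rightarrow> 'a \<Rightarrow> 'a set" where
  "peirce R e f = {e \<otimes>\<^bsub>R\<^esub> x \<otimes>\<^bsub>R\<^esub> f | x. x \<in> carrier R}"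

definition corner_ring :: "('a, 'r) ring_scheme \<Rightarrow> 'a \<Rightarrow> ('a, 'r) ring_scheme" where
  "corner_ring R e = R\<lparr>carrier := peirce R e e, one := e\<rparr>"

definition opposite_ring :: "('a, 'r) ring_scheme \<Rightarrow> ('a, 'r) ring_scheme" where
  "opposite_ring R = R\<lparr>monoid.mult := \<lambda>x y. y \<otimes>\<^bsub>R\<^esub> x\<rparr>"

text \<open>\<open>rdim D V d\<close>: the right vector space \<open>V\<close> over the division ring \<open>D\<close> has dimension \<open>d\<close>,
  that is, a basis with \<open>d\<close> elements.\<close>

definition rbasis :: "('a, 'r) ring_scheme \<Rightarrow> ('a, 'm, 'x) rmodule_scheme \<Rightarrow> 'm set \<Rightarrow> bool" where
  "rbasis D V B \<longleftrightarrow> finite B \<and> B \<subseteq> carrier V \<and>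
     (\<forall>c \<in> B \<rightarrow> carrier D. (\<Oplus>\<^bsub>V\<^esub>b\<in>B. b \<triangleleft>\<^bsub>V\<^esub> c b) = \<zero>\<^bsub>V\<^esub> \<longrightarrow> (\<forall>b\<in>B. c b = \<zero>\<^bsub>D\<^esub>)) \<and>
     (\<forall>v \<in> carrier V. \<exists>c \<in> B \<rightarrow> carrier D. v = (\<Oplus>\<^bsub>V\<^esub>b\<in>B. b \<triangleleft>\<^bsub>V\<^esub> c b))"

definition rdim :: "('a, 'r) ring_scheme \<Rightarrow> ('a, 'm, 'x) rmodule_scheme \<Rightarrow> nat \<Rightarrow> bool" where
  "rdim D V d \<longleftrightarrow> right_module D V \<and> (\<exists>B. rbasis D V B \<and> card B = d)"

definition peirce_right_dim :: "('a, 'r) ring_scheme \<Rightarrow> 'a \<Rightarrow> 'a \<Rightarrow> nat \<Rightarrow> bool" where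
  "peirce_right_dim R e f d \<longleftrightarrow>
     rdim (corner_ring R f) ((right_regular R)\<lparr>carrier := peirce R e f\<rparr>) d"

text \<open>A left vector space over \<open>eRe\<close> is a right vector space over the opposite ring of \<open>eRe\<close>;
  in \<open>right_regular (opposite_ring R)\<close> the action of \<open>a\<close> is left multiplication by \<open>a\<close> in \<open>R\<close>.\<close>

definition peirce_left_dim :: "('a, 'r) ring_scheme \<Rightarrow> 'a \<Rightarrow> 'a \<Rightarrow> nat \<Rightarrow> bool" where
  "peirce_left_dim R e f d \<longleftrightarrow>
     rdim (opposite_ring (corner_ring R e))
       ((right_regular (opposite_ring R))\<lparr>carrier := peirce R e f\<rparr>) d"

section \<open>Block upper triangular matrices\<close>

text \<open>Matrices are functions of two indices starting at \<open>1\<close>, with value \<open>\<zero>\<close> outside their bounds.\<close>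

definition matrices_over :: "('a, 'r) ring_scheme \<Rightarrow> nat \<Rightarrow> nat \<Rightarrow> 'a set \<Rightarrow> (nat \<Rightarrow> nat \<Rightarrow> 'a) set" where
  "matrices_over R p q S =
     {A. (\<forall>a\<in>{1..p}. \<forall>b\<in>{1..q}. A a b \<in> S) \<and>
         (\<forall>a b. \<not> (a \<in> {1..p} \<and> b \<in> {1..q}) \<longrightarrow> A a b = \<zero>\<^bsub>R\<^esub>)}"

text \<open>\<open>A i j\<close> is the block of \<open>A\<close> in block row \<open>i\<close> and block column \<open>j\<close>, so that
  \<open>A i j a b\<close> is an entry of that block.\<close>

definition block_upper_triangular_ring ::
  "('a, 'r) ring_scheme \<Rightarrow> nat \<Rightarrow> (nat \<Rightarrow> nat) \<Rightarrow> (nat \<Rightarrow> 'a) \<Rightarrow> (nat \<Rightarrow> nat \<Rightarrow> nat \<Rightarrow> nat \<Rightarrow> 'a) ring" where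
  "block_upper_triangular_ring R k n e =
     \<lparr>carrier = {A. \<forall>i j. (if 1 \<le> i \<and> i \<le> j \<and> j \<le> k
                       then A i j \<in> matrices_over R (n i) (n j) (peirce R (e i) (e j))
                       else A i j = (\<lambda>a b. \<zero>\<^bsub>R\<^esub>))},
      monoid.mult = (\<lambda>A B i j a b. \<Oplus>\<^bsub>R\<^esub>l\<in>{1..k}. \<Oplus>\<^bsub>R\<^esub>c\<in>{1..n l}. A i l a c \<otimes>\<^bsub>R\<^esub> B l j c b),
      monoid.one = (\<lambda>i j a b. if i = j \<and> i \<in> {1..k} \<and> a = b \<and> a \<in> {1..n i} then e i else \<zero>\<^bsub>R\<^esub>),
      ring.zero = (\<lambda>i j a b. \<zero>\<^bsub>R\<^esub>),
      ring.add = (\<lambda>A B i j a b. A i j a b \<oplus>\<^bsub>R\<^esub> B i j a b)\<rparr>"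

end

theory Submission
  imports Defs
begin

text \<open>
  The structure comes from right ideals \<open>e R\<close> that are uniform (any two nonzero submodules meet),
  for idempotents \<open>e\<close>.

  Such idempotents exist: by the descending chain condition each nonzero summand \<open>f R\<close> contains a
  minimal right ideal, which weak CS makes essential in a summand of \<open>R\<close>; nonsingularity moves that
  summand into \<open>f R\<close>, where it splits off.  The chain condition ends this process with a
  decomposition of \<open>\<one>\<close> into orthogonal uniform idempotents (\<open>uniform_decomposition\<close>).

  Nonsingularity also makes every nonzero \<open>a \<in> e R f\<close>, viewed as a homomorphism \<open>f R \<rightarrow> e R\<close>,
  injective (\<open>uniform_left_cancel\<close>): its kernel would be essential in the uniform module \<open>f R\<close>.
  Consequently products of nonzero elements of \<open>e R f\<close> and \<open>f R g\<close> are nonzero, the relation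
  \<open>e R f \<noteq> 0\<close> is a preorder on the idempotents, each \<open>e R e\<close> is a division ring by the chain
  condition, and two idempotents related in both directions generate isomorphic right ideals.
  Collecting isomorphic ones and refining the preorder to a linear order gives the block
  triangular form (\<open>block_triangular_decomposition\<close>).

  The a-ring condition enters through \<open>right_a_ring_extend\<close>: a monomorphism from a nonzero submodule
  of a uniform right ideal \<open>I\<close> into \<open>I\<close> extends to an endomorphism of \<open>I\<close>, because on the injective
  envelope it extends to an automorphism.  With \<open>I = e R\<close> this shows that any nonzero \<open>a \<in> e R f\<close>
  generates \<open>e R f\<close> over \<open>e R e\<close>; with \<open>I = a R\<close>, that it generates \<open>e R f\<close> over \<open>f R f\<close>.  So \<open>e R f\<close>
  has dimension one on both sides, and \<open>c a = a \<sigma>(c)\<close> defines an isomorphism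
  \<open>\<sigma> : e R e \<rightarrow> f R f\<close>.  Finally, the idempotents whose corner ring is isomorphic to a given one add
  up to a central idempotent, which is \<open>\<one>\<close> as \<open>R\<close> is indecomposable; hence all corners are isomorphic.
\<close>

section \<open>Submodules and right ideals\<close>

context right_module
begin

lemma ract_zero_left: "a \<in> carrier R \<Longrightarrow> \<zero>\<^bsub>M\<^esub> \<triangleleft>\<^bsub>M\<^esub> a = \<zero>\<^bsub>M\<^esub>"
  by (metis M.add.r_cancel_one M.l_zero M.zero_closed ract_add_left ract_closed)

lemma ract_zero_right: "x \<in> carrier M \<Longrightarrow> x \<triangleleft>\<^bsub>M\<^esub> \<zero>\<^bsub>R\<^esub> = \<zero>\<^bsub>M\<^esub>"
  by (metis M.add.r_cancel_one R.l_zero R.zero_closed ract_add_right ract_closed)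

lemma ract_minus_one:
  assumes "x \<in> carrier M" shows "x \<triangleleft>\<^bsub>M\<^esub> (\<ominus>\<^bsub>R\<^esub> \<one>\<^bsub>R\<^esub>) = \<ominus>\<^bsub>M\<^esub> x"
proof -
  have "x \<triangleleft>\<^bsub>M\<^esub> (\<ominus>\<^bsub>R\<^esub> \<one>\<^bsub>R\<^esub>) \<oplus>\<^bsub>M\<^esub> x = x \<triangleleft>\<^bsub>M\<^esub> (\<ominus>\<^bsub>R\<^esub> \<one>\<^bsub>R\<^esub> \<oplus>\<^bsub>R\<^esub> \<one>\<^bsub>R\<^esub>)"
    using assms by (simp add: ract_add_right ract_one)
  also have "\<dots> = \<zero>\<^bsub>M\<^esub>"
    using assms by (simp add: R.l_neg ract_zero_right)
  finally show ?thesis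
    using assms by (simp add: M.minus_equality ract_closed)
qed

text \<open>Negation is the action of \<open>\<ominus> \<one>\<close>, so closure under it comes for free.\<close>

lemma rsubmodule_iff:
  "rsubmodule R M N \<longleftrightarrow> N \<subseteq> carrier M \<and> \<zero>\<^bsub>M\<^esub> \<in> N \<and> (\<forall>x\<in>N. \<forall>y\<in>N. x \<oplus>\<^bsub>M\<^esub> y \<in> N)
     \<and> (\<forall>x\<in>N. \<forall>a\<in>carrier R. x \<triangleleft>\<^bsub>M\<^esub> a \<in> N)" (is "?L \<longleftrightarrow> ?R")
proof
  assume ?L
  then have s: "additive_subgroup N M" and a: "\<forall>x\<in>N. \<forall>a\<in>carrier R. x \<triangleleft>\<^bsub>M\<^esub> a \<in> N"
    by (auto simp: rsubmodule_def)
  interpret additive_subgroup N M by fact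
  show ?R using a a_subset a_closed zero_closed by auto
next
  assume r: ?R
  have "subgroup N (add_monoid M)"
  proof (rule subgroup.intro)
    fix x assume x: "x \<in> N"
    then have "\<ominus>\<^bsub>M\<^esub> x \<in> N"
      using r ract_minus_one by (metis R.add.inv_closed R.one_closed subsetD)
    then show "inv\<^bsub>add_monoid M\<^esub> x \<in> N" by (simp add: a_inv_def)
  qed (use r in auto)
  then show ?L using r by (simp add: rsubmodule_def additive_subgroup_def)
qed

lemma rsubmodule_right_module:
  assumes N: "rsubmodule R M N"
  shows "right_module R (M\<lparr>carrier := N\<rparr>)"
proof -
  note n = N[unfolded rsubmodule_iff]
  have inN: "\<And>x. x \<in> N \<Longrightarrow> x \<in> carrier M" using n by auto
  have "additive_subgroup N M" using N by (simp add: rsubmodule_def)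
  then have "subgroup N (add_monoid M)" by (simp add: additive_subgroup_def)
  then have "group ((add_monoid M)\<lparr>carrier := N\<rparr>)"
    by (rule subgroup.subgroup_is_group) (rule M.a_group)
  then have g: "group (add_monoid (M\<lparr>carrier := N\<rparr>))" by simp
  have "abelian_group (M\<lparr>carrier := N\<rparr>)"
    unfolding abelian_group_def abelian_group_axioms_def comm_group_def
  proof (intro conjI)
    show am: "abelian_monoid (M\<lparr>carrier := N\<rparr>)"
      by (rule abelian_monoidI) (use n inN M.a_assoc M.a_comm in auto)
    show "comm_monoid (add_monoid (M\<lparr>carrier := N\<rparr>))"
      using am by (simp add: abelian_monoid_def)
    show "group (add_monoid (M\<lparr>carrier := N\<rparr>))" by (rule g)
  qed
  then show ?thesis
    unfolding right_module_def right_module_axioms_def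
    using n inN R.ring_axioms ract_add_left ract_add_right ract_assoc ract_one by simp
qed

lemma rsubmodule_restrict_iff:
  assumes N: "rsubmodule R M N"
  shows "rsubmodule R (M\<lparr>carrier := N\<rparr>) K \<longleftrightarrow> rsubmodule R M K \<and> K \<subseteq> N"
  using N right_module.rsubmodule_iff[OF rsubmodule_right_module[OF N], of K]
  by (auto simp: rsubmodule_iff)

end

context ring
begin

lemma right_module_right_regular: "right_module R (right_regular R)"
proof -
  have "abelian_group (right_regular R)"
    by (rule abelian_groupI)
      (auto simp: right_regular_def a_ac intro: l_neg  add.l_inv_ex)
  then show ?thesis
    unfolding right_module_def right_module_axioms_def
    by (simp add: ring_axioms) (simp add: right_regular_def l_distr r_distr m_assoc)
qed

lemma right_ideal_iff:
  "right_ideal R I \<longleftrightarrow> I \<subseteq> carrier R \<and> \<zero> \<in> I \<and> (\<forall>x\<in>I. \<forall>y\<in>I. x \<oplus> y \<in> I)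
     \<and> (\<forall>x\<in>I. \<forall>a\<in>carrier R. x \<otimes> a \<in> I)"
  unfolding right_ideal_def right_module.rsubmodule_iff[OF right_module_right_regular]
  by (simp add: right_regular_def)

lemma right_ideal_right_module:
  "right_ideal R I \<Longrightarrow> right_module R ((right_regular R)\<lparr>carrier := I\<rparr>)"
  unfolding right_ideal_def by (rule right_module.rsubmodule_right_module[OF right_module_right_regular])

lemma right_idealD:
  assumes "right_ideal R I"
  shows "\<And>x. x \<in> I \<Longrightarrow> x \<in> carrier R" and "\<zero> \<in> I"
    and "\<And>x y. \<lbrakk>x \<in> I; y \<in> I\<rbrakk> \<Longrightarrow> x \<oplus> y \<in> I"
    and "\<And>x a. \<lbrakk>x \<in> I; a \<in> carrier R\<rbrakk> \<Longrightarrow> x \<otimes> a \<in> I"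
  using assms by (auto simp: right_ideal_iff)

lemma right_ideal_nonzeroE:
  assumes "right_ideal R I" "I \<noteq> {\<zero>}"
  obtains x where "x \<in> I" "x \<noteq> \<zero>"
  using assms right_idealD(2) by blast

lemma right_ideal_Int: "right_ideal R I \<Longrightarrow> right_ideal R J \<Longrightarrow> right_ideal R (I \<inter> J)"
  by (auto simp: right_ideal_iff)

lemma right_ideal_image:
  assumes "right_ideal R I" "a \<in> carrier R"
  shows "right_ideal R ((\<lambda>x. a \<otimes> x) ` I)"
proof -
  note i = right_idealD[OF assms(1)]
  show ?thesis
    unfolding right_ideal_iff
  proof (intro conjI ballI)
    show "\<zero> \<in> (\<lambda>x. a \<otimes> x) ` I" using i(2) assms(2) by (intro image_eqI[of _ _ \<zero>]) auto
    fix x assume "x \<in> (\<lambda>x. a \<otimes> x) ` I"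
    then obtain x' where x: "x = a \<otimes> x'" "x' \<in> I" by auto
    { fix y assume "y \<in> (\<lambda>x. a \<otimes> x) ` I"
      then obtain y' where y: "y = a \<otimes> y'" "y' \<in> I" by auto
      show "x \<oplus> y \<in> (\<lambda>x. a \<otimes> x) ` I"
        using x y i assms(2) by (intro image_eqI[of _ _ "x' \<oplus> y'"]) (auto simp: r_distr) }
    { fix b assume "b \<in> carrier R"
      then show "x \<otimes> b \<in> (\<lambda>x. a \<otimes> x) ` I"
        using x i assms(2) by (intro image_eqI[of _ _ "x' \<otimes> b"]) (auto simp: m_assoc) }
  qed (use i assms(2) in auto)
qed

lemma right_ideal_carrier: "right_ideal R (carrier R)"
  by (auto simp: right_ideal_iff)

end

definition principal_right_ideal :: "('a, 'r) ring_scheme \<Rightarrow> 'a \<Rightarrow> 'a set" where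
  "principal_right_ideal R a = (\<lambda>x. a \<otimes>\<^bsub>R\<^esub> x) ` carrier R"

definition uniform_right_ideal :: "('a, 'r) ring_scheme \<Rightarrow> 'a set \<Rightarrow> bool" where
  "uniform_right_ideal R I \<longleftrightarrow> right_ideal R I \<and> I \<noteq> {\<zero>\<^bsub>R\<^esub>} \<and>
     (\<forall>K L. right_ideal R K \<and> K \<subseteq> I \<and> K \<noteq> {\<zero>\<^bsub>R\<^esub>} \<and>
        right_ideal R L \<and> L \<subseteq> I \<and> L \<noteq> {\<zero>\<^bsub>R\<^esub>} \<longrightarrow> K \<inter> L \<noteq> {\<zero>\<^bsub>R\<^esub>})"

definition minimal_right_ideal :: "('a, 'r) ring_scheme \<Rightarrow> 'a set \<Rightarrow> bool" where
  "minimal_right_ideal R N \<longleftrightarrow> right_ideal R N \<and> N \<noteq> {\<zero>\<^bsub>R\<^esub>} \<and>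
     (\<forall>K. right_ideal R K \<and> K \<subseteq> N \<and> K \<noteq> {\<zero>\<^bsub>R\<^esub>} \<longrightarrow> K = N)"

definition uniform_idempotent :: "('a, 'r) ring_scheme \<Rightarrow> 'a \<Rightarrow> bool" where
  "uniform_idempotent R e \<longleftrightarrow> e \<in> carrier R \<and> e \<otimes>\<^bsub>R\<^esub> e = e \<and>
     uniform_right_ideal R (principal_right_ideal R e)"

context ring
begin

lemma right_ideal_principal: "a \<in> carrier R \<Longrightarrow> right_ideal R (principal_right_ideal R a)"
  unfolding principal_right_ideal_def by (rule right_ideal_image[OF right_ideal_carrier])

lemma principal_right_ideal_self: "a \<in> carrier R \<Longrightarrow> a \<in> principal_right_ideal R a"
  unfolding principal_right_ideal_def by (rule image_eqI[of _ _ \<one>]) auto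

lemma principal_idempotent_iff:
  assumes "e \<in> carrier R" "e \<otimes> e = e"
  shows "x \<in> principal_right_ideal R e \<longleftrightarrow> x \<in> carrier R \<and> e \<otimes> x = x"
proof
  assume "x \<in> principal_right_ideal R e"
  then obtain y where "y \<in> carrier R" "x = e \<otimes> y" by (auto simp: principal_right_ideal_def)
  then show "x \<in> carrier R \<and> e \<otimes> x = x" using assms by (simp flip: m_assoc)
qed (force simp: principal_right_ideal_def intro: rev_image_eqI)

lemma peirce_iff:
  assumes "e \<in> carrier R" "e \<otimes> e = e" "f \<in> carrier R" "f \<otimes> f = f"
  shows "x \<in> peirce R e f \<longleftrightarrow> x \<in> carrier R \<and> e \<otimes> x = x \<and> x \<otimes> f = x"
proof
  assume "x \<in> peirce R e f"
  then obtain y where y: "y \<in> carrier R" "x = e \<otimes> y \<otimes> f" by (auto simp: peirce_def)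
  have "e \<otimes> x = (e \<otimes> e) \<otimes> y \<otimes> f" using y assms(1,3) by (simp add: m_assoc)
  moreover have "x \<otimes> f = e \<otimes> y \<otimes> (f \<otimes> f)" using y assms(1,3) by (simp add: m_assoc)
  ultimately show "x \<in> carrier R \<and> e \<otimes> x = x \<and> x \<otimes> f = x" using y assms by simp
next
  assume "x \<in> carrier R \<and> e \<otimes> x = x \<and> x \<otimes> f = x"
  then show "x \<in> peirce R e f" unfolding peirce_def by (intro CollectI exI[of _ x]) auto
qed

lemma uniform_idempotentD:
  assumes "uniform_idempotent R e"
  shows "e \<in> carrier R" "e \<otimes> e = e" "e \<noteq> \<zero>"
proof -
  show c: "e \<in> carrier R" "e \<otimes> e = e" using assms by (auto simp: uniform_idempotent_def)
  have "principal_right_ideal R e \<noteq> {\<zero>}"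
    using assms by (auto simp: uniform_idempotent_def uniform_right_ideal_def)
  moreover have "principal_right_ideal R \<zero> = {\<zero>}"
    by (auto simp: principal_right_ideal_def)
  ultimately show "e \<noteq> \<zero>" by auto
qed

lemma uniform_peirce_iff:
  assumes "uniform_idempotent R e" "uniform_idempotent R f"
  shows "x \<in> peirce R e f \<longleftrightarrow> x \<in> carrier R \<and> e \<otimes> x = x \<and> x \<otimes> f = x"
  using peirce_iff uniform_idempotentD assms by blast

lemma peirce_mult_closed:
  assumes "uniform_idempotent R e" "uniform_idempotent R f" "uniform_idempotent R g"
    and "a \<in> peirce R e f" "b \<in> peirce R f g"
  shows "a \<otimes> b \<in> peirce R e g"
proof -
  note p = uniform_peirce_iff[OF assms(1,2)] uniform_peirce_iff[OF assms(2,3)] uniform_peirce_iff[OF assms(1,3)]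
  note u = uniform_idempotentD[OF assms(1)] uniform_idempotentD[OF assms(3)]
  have "e \<otimes> (a \<otimes> b) = a \<otimes> b" using assms(4,5) p u by (simp flip: m_assoc)
  moreover have "a \<otimes> b \<otimes> g = a \<otimes> b" using assms(4,5) p u by (simp add: m_assoc)
  ultimately show ?thesis using assms(4,5) p by simp
qed

lemma peirce_add_closed:
  assumes "uniform_idempotent R e" "uniform_idempotent R f"
    and "a \<in> peirce R e f" "b \<in> peirce R e f"
  shows "a \<oplus> b \<in> peirce R e f"
  using assms(3,4) uniform_peirce_iff[OF assms(1,2)] uniform_idempotentD[OF assms(1)]
    uniform_idempotentD[OF assms(2)] by (auto simp: l_distr r_distr)

section \<open>Nonsingularity and cancellation\<close>

text \<open>
  Nonsingularity is always used in this form: the hypothesis says that the right annihilator of \<open>c\<close>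
  is essential, elementwise.
\<close>

lemma right_nonsingularD:
  assumes "right_nonsingular R" "c \<in> carrier R"
    and ann: "\<And>L. \<lbrakk>right_ideal R L; L \<noteq> {\<zero>}\<rbrakk> \<Longrightarrow> \<exists>l\<in>L. l \<noteq> \<zero> \<and> c \<otimes> l = \<zero>"
  shows "c = \<zero>"
proof -
  have [simp]: "\<zero>\<^bsub>right_regular R\<^esub> = \<zero>" by (simp add: right_regular_def)
  have "right_ideal R (right_annihilator R c)"
    using \<open>c \<in> carrier R\<close>
    by (auto simp: right_ideal_iff right_annihilator_def r_distr simp flip: m_assoc)
  moreover have "right_annihilator R c \<inter> L \<noteq> {\<zero>}" if "right_ideal R L" "L \<noteq> {\<zero>}" for L
    using ann[OF that] right_idealD(1)[OF that(1)] by (auto simp: right_annihilator_def)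
  ultimately have "essential_in R (right_regular R) (right_annihilator R c)"
    by (auto simp: essential_in_def simp flip: right_ideal_def)
  then show ?thesis
    using assms(1,2) by (auto simp: right_nonsingular_def right_singular_ideal_def)
qed

text \<open>
  If \<open>a x = 0\<close> with \<open>0 \<noteq> x \<in> e R\<close>, then the kernel \<open>K\<close> of left multiplication by \<open>a\<close> on the uniform
  module \<open>e R\<close> is essential in \<open>e R\<close>.  Its preimage under left multiplication by \<open>e\<close> is then essential
  in \<open>R\<close> and annihilated by \<open>a = a e\<close>, so \<open>a\<close> is a singular element.
\<close>

lemma uniform_left_cancel:
  assumes "right_nonsingular R" "uniform_idempotent R e" "a \<in> carrier R" "a \<otimes> e = a" "a \<noteq> \<zero>"
    and x: "x \<in> carrier R" "e \<otimes> x = x" "a \<otimes> x = \<zero>"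
  shows "x = \<zero>"
proof (rule ccontr)
  assume "x \<noteq> \<zero>"
  note e = uniform_idempotentD[OF assms(2)]
  define K where "K = {y \<in> carrier R. e \<otimes> y = y \<and> a \<otimes> y = \<zero>}"
  have K: "right_ideal R K"
    using e assms(3) by (auto simp: right_ideal_iff K_def r_distr simp flip: m_assoc)
  have Ke: "K \<subseteq> principal_right_ideal R e"
    using principal_idempotent_iff[OF e(1,2)] by (auto simp: K_def)
  have "K \<noteq> {\<zero>}" using x \<open>x \<noteq> \<zero>\<close> by (auto simp: K_def)
  have "a = \<zero>"
  proof (rule right_nonsingularD[OF assms(1,3)])
    fix L assume L: "right_ideal R L" "L \<noteq> {\<zero>}"
    show "\<exists>l\<in>L. l \<noteq> \<zero> \<and> a \<otimes> l = \<zero>"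
    proof (cases "(\<lambda>x. e \<otimes> x) ` L = {\<zero>}")
      case True
      obtain l where l: "l \<in> L" "l \<noteq> \<zero>" using L by (rule right_ideal_nonzeroE)
      have "a \<otimes> l = a \<otimes> (e \<otimes> l)"
        using assms(3,4) e(1) right_idealD(1)[OF L(1) l(1)] by (simp flip: m_assoc)
      then show ?thesis using True l assms(3) by (metis image_eqI r_null singletonD)
    next
      case False
      have "right_ideal R ((\<lambda>x. e \<otimes> x) ` L)" using L(1) e(1) by (rule right_ideal_image)
      moreover have "(\<lambda>x. e \<otimes> x) ` L \<subseteq> principal_right_ideal R e"
        using right_idealD(1)[OF L(1)] by (auto simp: principal_right_ideal_def)
      ultimately have "(\<lambda>x. e \<otimes> x) ` L \<inter> K \<noteq> {\<zero>}"
        using assms(2) K Ke \<open>K \<noteq> {\<zero>}\<close> False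
        unfolding uniform_idempotent_def uniform_right_ideal_def by blast
      moreover have "right_ideal R ((\<lambda>x. e \<otimes> x) ` L \<inter> K)"
        using \<open>right_ideal R ((\<lambda>x. e \<otimes> x) ` L)\<close> K by (rule right_ideal_Int)
      ultimately obtain y where "y \<in> (\<lambda>x. e \<otimes> x) ` L \<inter> K" "y \<noteq> \<zero>"
        by (metis right_ideal_nonzeroE)
      then obtain l where l: "l \<in> L" "e \<otimes> l \<noteq> \<zero>" "a \<otimes> (e \<otimes> l) = \<zero>" by (auto simp: K_def)
      then have "a \<otimes> l = \<zero>"
        using assms(3,4) e(1) right_idealD(1)[OF L(1) l(1)] by (simp flip: m_assoc)
      moreover have "l \<noteq> \<zero>" using l(2) e(1) by auto
      ultimately show ?thesis using l(1) by auto
    qed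
  qed
  then show False using assms(5) by simp
qed

lemma peirce_mult_nonzero:
  assumes "right_nonsingular R" "uniform_idempotent R e" "uniform_idempotent R f" "uniform_idempotent R g"
    and "a \<in> peirce R e f" "b \<in> peirce R f g" "a \<noteq> \<zero>" "b \<noteq> \<zero>"
  shows "a \<otimes> b \<noteq> \<zero>"
  using uniform_left_cancel[OF assms(1,3), of a b] assms(5-)
    uniform_peirce_iff[OF assms(2,3)] uniform_peirce_iff[OF assms(3,4)] by auto

section \<open>Decomposition of the identity into uniform idempotents\<close>

lemma right_ideal_minus:
  assumes "right_ideal R I" "x \<in> I" "y \<in> I" shows "x \<ominus> y \<in> I"
proof -
  note i = right_idealD[OF assms(1)]
  have "y \<otimes> (\<ominus> \<one>) = \<ominus> y" using i(1)[OF assms(3)] by (simp add: r_minus)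
  then have "\<ominus> y \<in> I" using i(4)[OF assms(3), of "\<ominus> \<one>"] by simp
  then show ?thesis using i(3) assms(2) by (simp add: a_minus_def)
qed

lemma right_artinianD:
  assumes "right_artinian R" "\<And>m. right_ideal R (I m)" "\<And>m. I (Suc m) \<subseteq> I m"
  shows "\<exists>N. \<forall>m\<ge>N. I m = I N"
  using assms(1)[unfolded right_artinian_def, THEN conjunct2, THEN spec, of I] assms(2,3) by simp

lemma right_artinian_wf:
  assumes "right_artinian R"
  shows "wf {(J, I). right_ideal R J \<and> right_ideal R I \<and> J \<subset> I}"
proof (rule ccontr)
  assume "\<not> ?thesis"
  then obtain I where "\<forall>m. (I (Suc m), I m) \<in> {(J, I). right_ideal R J \<and> right_ideal R I \<and> J \<subset> I}"
    unfolding wf_iff_no_infinite_down_chain by blast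
  then have I: "\<And>m. right_ideal R (I (Suc m)) \<and> right_ideal R (I m) \<and> I (Suc m) \<subset> I m" by auto
  have "\<exists>N. \<forall>m\<ge>N. I m = I N"
    by (rule right_artinianD[OF assms]) (use I in auto)
  then obtain N where "\<forall>m\<ge>N. I m = I N" ..
  then have "I (Suc N) = I N" using le_SucI[OF le_refl] by blast
  then show False using I[of N] by auto
qed

lemma minimal_right_ideal_exists:
  assumes "right_artinian R" "right_ideal R I" "I \<noteq> {\<zero>}"
  shows "\<exists>N. minimal_right_ideal R N \<and> N \<subseteq> I"
proof -
  let ?Q = "{J. right_ideal R J \<and> J \<noteq> {\<zero>} \<and> J \<subseteq> I}"
  have "I \<in> ?Q" using assms by auto
  then obtain N where N: "N \<in> ?Q"
    "\<And>J. (J, N) \<in> {(J, I). right_ideal R J \<and> right_ideal R I \<and> J \<subset> I} \<Longrightarrow> J \<notin> ?Q"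
    by (rule wfE_min[OF right_artinian_wf[OF assms(1)]]) auto
  have "K = N" if "right_ideal R K" "K \<subseteq> N" "K \<noteq> {\<zero>}" for K
  proof (rule ccontr)
    assume "K \<noteq> N"
    then have "K \<notin> ?Q" using that N(1) by (intro N(2)) auto
    then show False using that N(1) by auto
  qed
  then have "minimal_right_ideal R N"
    using N(1) by (simp add: minimal_right_ideal_def)
  then show ?thesis using N by auto
qed

lemma minimal_right_ideal_semisimple:
  assumes "minimal_right_ideal R N"
  shows "semisimple_rmodule R ((right_regular R)\<lparr>carrier := N\<rparr>)"
  unfolding semisimple_rmodule_def
proof (intro conjI allI impI)
  let ?N = "(right_regular R)\<lparr>carrier := N\<rparr>"
  have N: "right_ideal R N" using assms by (simp add: minimal_right_ideal_def)
  then show m: "right_module R ?N" by (rule right_ideal_right_module)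
  have sub: "rsubmodule R ?N K \<longleftrightarrow> right_ideal R K \<and> K \<subseteq> N" for K
    using right_module.rsubmodule_restrict_iff[OF right_module_right_regular, of N K] N
    by (simp add: right_ideal_def)
  have z: "right_ideal R {\<zero>}" by (auto simp: right_ideal_iff)
  note nD = right_idealD[OF N]
  fix K assume K: "rsubmodule R ?N K"
  then have "K = {\<zero>} \<or> K = N" using assms by (auto simp: sub minimal_right_ideal_def)
  moreover have "{\<zero>} <+>\<^bsub>?N\<^esub> N = N" "N <+>\<^bsub>?N\<^esub> {\<zero>} = N"
    using nD(1) by (auto simp: set_add_def set_mult_def right_regular_def)
  moreover have "rsubmodule R ?N {\<zero>}" "rsubmodule R ?N N" using z N nD(2) by (auto simp: sub)
  moreover have "\<zero>\<^bsub>?N\<^esub> = \<zero>" "carrier ?N = N" "{\<zero>} \<inter> N = {\<zero>}" "N \<inter> {\<zero>} = {\<zero>}"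
    using nD(2) by (auto simp: right_regular_def)
  ultimately show "direct_summand R ?N K"
    unfolding direct_summand_def by metis
qed

text \<open>The projection of \<open>\<one>\<close> to the summand is a left identity of it.\<close>

lemma direct_summand_left_identity:
  assumes "direct_summand R (right_regular R) K"
  shows "\<exists>g\<in>K. \<forall>x\<in>K. g \<otimes> x = x"
proof -
  obtain L where K: "right_ideal R K" and L: "right_ideal R L" and KL: "K \<inter> L = {\<zero>}"
    and sum: "K <+>\<^bsub>right_regular R\<^esub> L = carrier R"
    using assms unfolding direct_summand_def right_ideal_def by (auto simp: right_regular_def)
  have "\<one> \<in> K <+>\<^bsub>right_regular R\<^esub> L" using sum by simp
  then obtain g l where g: "g \<in> K" "l \<in> L" "\<one> = g \<oplus> l"
    by (auto simp: set_add_def set_mult_def right_regular_def)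
  have "g \<otimes> x = x" if x: "x \<in> K" for x
  proof -
    have c: "x \<in> carrier R" "g \<in> carrier R" "l \<in> carrier R"
      using x g right_idealD(1)[OF K] right_idealD(1)[OF L] by auto
    have "x = (g \<oplus> l) \<otimes> x" unfolding g(3)[symmetric] using c by simp
    also have "\<dots> = l \<otimes> x \<oplus> g \<otimes> x" using c by (simp add: l_distr a_comm)
    finally have "x \<ominus> g \<otimes> x = l \<otimes> x" using c by (metis add.inv_solve_right' m_closed minus_eq)
    moreover have "x \<ominus> g \<otimes> x \<in> K"
      using right_ideal_minus[OF K x] right_idealD(4)[OF K g(1) c(1)] by simp
    moreover have "l \<otimes> x \<in> L" using right_idealD(4)[OF L g(2) c(1)] .
    ultimately have "x \<ominus> g \<otimes> x = \<zero>" using KL by auto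
    then show "g \<otimes> x = x" using c by (metis m_closed r_right_minus_eq)
  qed
  then show ?thesis using g(1) by auto
qed

text \<open>Every nonzero submodule of \<open>K\<close> contains the essential minimal right ideal \<open>N\<close>.\<close>

lemma uniform_of_essential_minimal:
  assumes K: "right_ideal R K" and N: "minimal_right_ideal R N" and "N \<subseteq> K"
    and ess: "\<And>L. \<lbrakk>right_ideal R L; L \<subseteq> K; L \<noteq> {\<zero>}\<rbrakk> \<Longrightarrow> N \<inter> L \<noteq> {\<zero>}"
  shows "uniform_right_ideal R K"
proof -
  have n: "right_ideal R N" "N \<noteq> {\<zero>}" using N by (auto simp: minimal_right_ideal_def)
  have NL: "N \<subseteq> L" if "right_ideal R L" "L \<subseteq> K" "L \<noteq> {\<zero>}" for L
    using ess[OF that] N right_ideal_Int[OF n(1) that(1)] unfolding minimal_right_ideal_def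
    by (metis inf.orderI inf_le1)
  have "K \<noteq> {\<zero>}" using n \<open>N \<subseteq> K\<close> right_idealD(2)[OF n(1)] by auto
  moreover have "L \<inter> L' \<noteq> {\<zero>}" if "N \<subseteq> L" "N \<subseteq> L'" for L L'
    using that n right_idealD(2)[OF n(1)] by blast
  ultimately show ?thesis using K NL unfolding uniform_right_ideal_def by simp
qed

text \<open>
  A minimal right ideal \<open>N\<close> below \<open>f\<close> is essential in a summand \<open>K\<close> of \<open>R\<close>.  Nonsingularity
  forces \<open>K\<close> into \<open>f R\<close>: for \<open>x \<in> K\<close> the element \<open>x - f x\<close> annihilates all \<open>l\<close> with \<open>x l \<in> N\<close>,
  and these form an essential right ideal.
\<close>

lemma uniform_idempotent_below:
  assumes "right_artinian R" "right_nonsingular R" "right_weak_CS R"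
    and f: "f \<in> carrier R" "f \<otimes> f = f" "f \<noteq> \<zero>"
  shows "\<exists>e. uniform_idempotent R e \<and> f \<otimes> e = e \<and> e \<otimes> f = e"
proof -
  have [simp]: "\<zero>\<^bsub>right_regular R\<^esub> = \<zero>" by (simp add: right_regular_def)
  have "principal_right_ideal R f \<noteq> {\<zero>}"
    using principal_right_ideal_self[OF f(1)] f(3) by auto
  then obtain N where N: "minimal_right_ideal R N" "N \<subseteq> principal_right_ideal R f"
    using minimal_right_ideal_exists[OF assms(1) right_ideal_principal[OF f(1)]] by auto
  then have n: "right_ideal R N" "N \<noteq> {\<zero>}" by (auto simp: minimal_right_ideal_def)
  then obtain K where K: "direct_summand R (right_regular R) K" "N \<subseteq> K"
    and ess0: "essential_in R ((right_regular R)\<lparr>carrier := K\<rparr>) N"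
    using assms(3) minimal_right_ideal_semisimple[OF N(1)]
    unfolding right_weak_CS_def weak_CS_def right_ideal_def by blast
  have Ki: "right_ideal R K" using K by (simp add: direct_summand_def right_ideal_def)
  have ess: "N \<inter> L \<noteq> {\<zero>}" if "right_ideal R L" "L \<subseteq> K" "L \<noteq> {\<zero>}" for L
    using ess0 that right_module.rsubmodule_restrict_iff[OF right_module_right_regular, of K L] Ki
    by (simp add: right_ideal_def essential_in_def)
  have fx: "f \<otimes> x = x" if x: "x \<in> K" for x
  proof -
    have xc: "x \<in> carrier R" using right_idealD(1)[OF Ki x] .
    have "x \<ominus> f \<otimes> x = \<zero>"
    proof (rule right_nonsingularD[OF assms(2)])
      fix L assume L: "right_ideal R L" "L \<noteq> {\<zero>}"
      show "\<exists>l\<in>L. l \<noteq> \<zero> \<and> (x \<ominus> f \<otimes> x) \<otimes> l = \<zero>"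
      proof (cases "(\<lambda>l. x \<otimes> l) ` L = {\<zero>}")
        case True
        obtain l where l: "l \<in> L" "l \<noteq> \<zero>" using L by (rule right_ideal_nonzeroE)
        then have "l \<in> carrier R" "x \<otimes> l = \<zero>" using True right_idealD(1)[OF L(1)] by auto
        then have "(x \<ominus> f \<otimes> x) \<otimes> l = \<zero>"
          using xc f(1) by (simp add: minus_eq l_distr l_minus m_assoc)
        then show ?thesis using l by auto
      next
        case False
        have xL: "right_ideal R ((\<lambda>l. x \<otimes> l) ` L)" using L(1) xc by (rule right_ideal_image)
        moreover have "(\<lambda>l. x \<otimes> l) ` L \<subseteq> K"
          using right_idealD(4)[OF Ki x] right_idealD(1)[OF L(1)] by auto
        ultimately have "N \<inter> (\<lambda>l. x \<otimes> l) ` L \<noteq> {\<zero>}" using ess False by auto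
        then obtain y where "y \<in> N \<inter> (\<lambda>l. x \<otimes> l) ` L" "y \<noteq> \<zero>"
          using right_ideal_Int[OF n(1) xL] by (metis right_ideal_nonzeroE)
        then obtain l where l: "l \<in> L" "x \<otimes> l \<noteq> \<zero>" "x \<otimes> l \<in> N" by auto
        then have lc: "l \<in> carrier R" using right_idealD(1)[OF L(1)] by auto
        have "f \<otimes> (x \<otimes> l) = x \<otimes> l"
          using l N(2) principal_idempotent_iff[OF f(1,2)] by auto
        then have "(x \<ominus> f \<otimes> x) \<otimes> l = \<zero>"
          using xc f(1) lc by (simp add: minus_eq l_distr l_minus m_assoc r_neg)
        moreover have "l \<noteq> \<zero>" using l(2) xc by auto
        ultimately show ?thesis using l by auto
      qed
    qed (use xc f in auto)
    then show ?thesis using xc f(1) by (metis m_closed r_right_minus_eq)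
  qed
  obtain g where g: "g \<in> K" "\<And>x. x \<in> K \<Longrightarrow> g \<otimes> x = x"
    using direct_summand_left_identity[OF K(1)] by auto
  have gc: "g \<in> carrier R" using right_idealD(1)[OF Ki g(1)] .
  \<comment> \<open>Only \<open>f g = g\<close> is known of \<open>g\<close>; replacing it by \<open>g f\<close> keeps the right ideal \<open>K\<close> and gives an
    element of \<open>f R f\<close>.\<close>
  define e where "e = g \<otimes> f"
  have eK: "e \<in> K" using right_idealD(4)[OF Ki g(1) f(1)] by (simp add: e_def)
  have ec: "e \<in> carrier R" using right_idealD(1)[OF Ki eK] .
  have ef: "f \<otimes> e = e" "e \<otimes> f = e" using fx[OF eK] gc f by (auto simp: e_def m_assoc)
  have ex: "e \<otimes> x = x" if "x \<in> K" for x
    using fx[OF that] g(2)[OF that] gc f(1) right_idealD(1)[OF Ki that] by (simp add: e_def m_assoc)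
  have "principal_right_ideal R e = K"
    using ex right_idealD(1,4)[OF Ki] eK by (force simp: principal_right_ideal_def intro: rev_image_eqI)
  moreover have "uniform_right_ideal R K"
    using Ki N(1) K(2) ess by (rule uniform_of_essential_minimal)
  ultimately show ?thesis
    using ec ef ex[OF eK] by (auto simp: uniform_idempotent_def)
qed

text \<open>
  Splitting a uniform \<open>e\<close> off \<open>f\<close> leaves \<open>f - e\<close>, and \<open>(f - e) R\<close> is strictly smaller than \<open>f R\<close> because
  it does not contain \<open>e\<close>.  So the descending chain condition ends the process.
\<close>

lemma uniform_decomposition:
  assumes "right_artinian R" "right_nonsingular R" "right_weak_CS R"
    and "f \<in> carrier R" "f \<otimes> f = f"
  shows "\<exists>F. finite F \<and> (\<forall>e\<in>F. uniform_idempotent R e \<and> f \<otimes> e = e \<and> e \<otimes> f = e) \<and>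
    (\<forall>e\<in>F. \<forall>e'\<in>F. e \<noteq> e' \<longrightarrow> e \<otimes> e' = \<zero>) \<and> (\<Oplus>e\<in>F. e) = f"
  using assms(4,5)
proof (induction "principal_right_ideal R f" arbitrary: f rule: wf_induct_rule[OF right_artinian_wf[OF assms(1)]])
  case (1 f)
  note f = 1(2,3)
  show ?case
  proof (cases "f = \<zero>")
    case True
    then show ?thesis by (intro exI[of _ "{}"]) auto
  next
    case False
    obtain e where ue: "uniform_idempotent R e" and ef: "f \<otimes> e = e" "e \<otimes> f = e"
      using uniform_idempotent_below[OF assms(1-3) f False] by auto
    note e = uniform_idempotentD[OF ue]
    let ?f = "f \<ominus> e"
    have c: "?f \<in> carrier R" using f(1) e(1) by auto
    have fe: "e \<otimes> ?f = \<zero>" "f \<otimes> ?f = ?f" "?f \<otimes> e = \<zero>" "?f \<otimes> f = ?f"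
      using f e ef by (auto simp: minus_eq r_distr l_distr r_minus l_minus r_neg)
    then have ff: "?f \<otimes> ?f = ?f"
      using f(1) e(1) c by (subst (1) minus_eq) (simp add: l_distr l_minus)
    have "principal_right_ideal R ?f \<subset> principal_right_ideal R f"
    proof
      show "principal_right_ideal R ?f \<subseteq> principal_right_ideal R f"
        using principal_idempotent_iff[OF c ff] principal_idempotent_iff[OF f] fe(2) c f(1)
        by (metis m_assoc subsetI)
      have "?f \<otimes> e \<noteq> e" using fe(3) e(3) by simp
      then show "principal_right_ideal R ?f \<noteq> principal_right_ideal R f"
        using principal_idempotent_iff[OF c ff, of e] principal_idempotent_iff[OF f, of e] e(1) ef(1) by auto
    qed
    then obtain F where F: "finite F"
      "\<And>e'. e' \<in> F \<Longrightarrow> uniform_idempotent R e' \<and> ?f \<otimes> e' = e' \<and> e' \<otimes> ?f = e'"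
      "\<And>e' e''. \<lbrakk>e' \<in> F; e'' \<in> F; e' \<noteq> e''\<rbrakk> \<Longrightarrow> e' \<otimes> e'' = \<zero>" "(\<Oplus>e\<in>F. e) = ?f"
      using 1(1)[of ?f] right_ideal_principal[OF c] right_ideal_principal[OF f(1)] c ff by blast
    have Fc: "F \<subseteq> carrier R" using F(2) uniform_idempotentD(1) by auto
    have eF: "e \<otimes> e' = \<zero>" "e' \<otimes> e = \<zero>" "f \<otimes> e' = e'" "e' \<otimes> f = e'" if "e' \<in> F" for e'
    proof -
      have e': "e' \<in> carrier R" "?f \<otimes> e' = e'" "e' \<otimes> ?f = e'"
        using F(2)[OF that] uniform_idempotentD(1) by auto
      show "e \<otimes> e' = \<zero>" using m_assoc[OF e(1) c e'(1)] fe(1) e' by simp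
      show "e' \<otimes> e = \<zero>" using m_assoc[OF e'(1) c e(1)] fe(3) e' by simp
      show "f \<otimes> e' = e'" using m_assoc[OF f(1) c e'(1)] fe(2) e' by simp
      show "e' \<otimes> f = e'" using m_assoc[OF e'(1) c f(1)] fe(4) e' by simp
    qed
    have "e \<notin> F" using eF(1) e(2,3) by force
    have "(\<Oplus>e\<in>insert e F. e) = e \<oplus> ?f"
      using F(1,4) Fc e(1) \<open>e \<notin> F\<close> by (subst finsum_insert) auto
    also have "\<dots> = f" using e(1) f(1) by (simp add: minus_eq a_lcomm[of e f] r_neg)
    finally show ?thesis
      using F eF ue ef by (intro exI[of _ "insert e F"]) auto
  qed
qed

section \<open>Corners at uniform idempotents\<close>

text \<open>
  Left multiplication by \<open>a\<close> is injective on \<open>e R\<close>, so the chain \<open>a\<^sup>m R\<close> becoming stationary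
  makes it surjective as well.
\<close>

lemma uniform_corner_right_inverse:
  assumes "right_artinian R" "right_nonsingular R" "uniform_idempotent R e"
    and "a \<in> peirce R e e" "a \<noteq> \<zero>"
  shows "\<exists>b\<in>peirce R e e. a \<otimes> b = e"
proof -
  note e = uniform_idempotentD[OF assms(3)]
  have a: "a \<in> carrier R" "e \<otimes> a = a" "a \<otimes> e = a"
    using assms(4) uniform_peirce_iff[OF assms(3,3)] by auto
  define I where "I m = principal_right_ideal R (a [^] (m::nat))" for m
  have "I (Suc m) \<subseteq> I m" for m
    using a(1) by (auto simp: I_def principal_right_ideal_def m_assoc)
  then have "\<exists>N. \<forall>m\<ge>N. I m = I N"
    using a(1) right_ideal_principal by (intro right_artinianD[OF assms(1)]) (auto simp: I_def)
  then obtain m where "I m = I (Suc m)" by (metis Suc_n_not_le_n nat_le_linear)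
  then have "a [^] m \<in> I (Suc m)"
    using principal_right_ideal_self[of "a [^] m"] a(1) by (auto simp: I_def)
  then obtain b where b: "b \<in> carrier R" "a [^] m = a [^] m \<otimes> a \<otimes> b"
    by (auto simp: I_def principal_right_ideal_def)
  have cancel: "x = \<zero>" if "a [^] n \<otimes> x = \<zero>" "x \<in> carrier R" "e \<otimes> x = x" for n :: nat and x
    using that
  proof (induction n arbitrary: x)
    case (Suc n)
    have "a [^] n \<otimes> (a \<otimes> x) = \<zero>" using Suc(2,3) a(1) by (simp add: m_assoc)
    moreover have "e \<otimes> (a \<otimes> x) = a \<otimes> x" using a e(1) Suc(3) by (simp flip: m_assoc)
    ultimately have "a \<otimes> x = \<zero>" using Suc.IH Suc(3) a(1) by simp
    then show ?case using uniform_left_cancel[OF assms(2,3) a(1,3) assms(5) Suc(3,4)] by simp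
  qed simp
  let ?b = "e \<otimes> b \<otimes> e"
  have ab: "a \<otimes> ?b = a \<otimes> b \<otimes> e" using a e b by (simp flip: m_assoc)
  have "a [^] m \<otimes> (e \<ominus> a \<otimes> b \<otimes> e) = a [^] m \<otimes> e \<ominus> (a [^] m \<otimes> a \<otimes> b) \<otimes> e"
    using a(1) b(1) e(1) by (simp add: minus_eq r_distr r_minus m_assoc)
  also have "\<dots> = \<zero>" using b e(1) a(1) by (simp add: minus_eq r_neg flip: b(2))
  finally have "e \<ominus> a \<otimes> b \<otimes> e = \<zero>"
    by (rule cancel) (use a b e in \<open>auto simp: minus_eq r_distr r_minus simp flip: m_assoc\<close>)
  then have "a \<otimes> ?b = e" using ab a(1) b(1) e(1) by (metis m_closed r_right_minus_eq)
  moreover have "?b \<in> peirce R e e" using b(1) by (auto simp: peirce_def)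
  ultimately show ?thesis by auto
qed

text \<open>The right inverse \<open>b\<close> of \<open>a\<close> is nonzero and so has a right inverse \<open>c\<close> itself; then \<open>a = a (b c) = (a b) c = c\<close>.\<close>

lemma uniform_corner_inverse:
  assumes "right_artinian R" "right_nonsingular R" "uniform_idempotent R e"
    and "a \<in> peirce R e e" "a \<noteq> \<zero>"
  shows "\<exists>b\<in>peirce R e e. a \<otimes> b = e \<and> b \<otimes> a = e"
proof -
  note e = uniform_idempotentD[OF assms(3)]
  note p = uniform_peirce_iff[OF assms(3,3)]
  obtain b where b: "b \<in> peirce R e e" "a \<otimes> b = e"
    using uniform_corner_right_inverse[OF assms] by auto
  then have "b \<noteq> \<zero>" using e(3) assms(4) p by auto
  then obtain c where c: "c \<in> peirce R e e" "b \<otimes> c = e"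
    using uniform_corner_right_inverse[OF assms(1-3) b(1)] by auto
  have "a = a \<otimes> (b \<otimes> c)" using c assms(4) p by simp
  also have "\<dots> = (a \<otimes> b) \<otimes> c"
    by (rule m_assoc[symmetric]) (use b c assms(4) p in auto)
  also have "\<dots> = c" using b c p by simp
  finally show ?thesis using b c by auto
qed

text \<open>
  For nonzero \<open>u \<in> e R f\<close> and \<open>v \<in> f R e\<close> the product \<open>u v\<close> is nonzero, hence invertible in \<open>e R e\<close>, and
  rescaling \<open>v\<close> makes it \<open>e\<close>.  Cancelling \<open>u\<close> in \<open>u (v u) = u f\<close> gives \<open>v u = f\<close>.  Thus \<open>u\<close> and \<open>v\<close> are
  mutually inverse isomorphisms between \<open>f R\<close> and \<open>e R\<close>.
\<close>

lemma uniform_peirce_mutual: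
  assumes "right_artinian R" "right_nonsingular R"
    and ef: "uniform_idempotent R e" "uniform_idempotent R f"
    and ne: "peirce R e f \<noteq> {\<zero>}" "peirce R f e \<noteq> {\<zero>}"
  shows "\<exists>u\<in>peirce R e f. \<exists>v\<in>peirce R f e. u \<otimes> v = e \<and> v \<otimes> u = f"
proof -
  note e = uniform_idempotentD[OF ef(1)] and f = uniform_idempotentD[OF ef(2)]
  note pef = uniform_peirce_iff[OF ef(1,2)] and pfe = uniform_peirce_iff[OF ef(2,1)]
    and pee = uniform_peirce_iff[OF ef(1,1)]
  have "\<zero> \<in> peirce R e f" "\<zero> \<in> peirce R f e" using e f pef pfe by auto
  then obtain u v where u: "u \<in> peirce R e f" "u \<noteq> \<zero>" and v: "v \<in> peirce R f e" "v \<noteq> \<zero>"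
    using ne by blast
  have uv: "u \<otimes> v \<in> peirce R e e" "u \<otimes> v \<noteq> \<zero>"
    using peirce_mult_closed[OF ef ef(1) u(1) v(1)]
      peirce_mult_nonzero[OF assms(2) ef ef(1) u(1) v(1) u(2) v(2)] by auto
  then obtain w where w: "w \<in> peirce R e e" "u \<otimes> v \<otimes> w = e"
    using uniform_corner_inverse[OF assms(1,2) ef(1)] by blast
  define v' where "v' = v \<otimes> w"
  note cl = u(1)[unfolded pef] v(1)[unfolded pfe] w(1)[unfolded pee]
  have v': "v' \<in> peirce R f e" unfolding pfe v'_def using cl e f by (metis m_assoc m_closed)
  have uv': "u \<otimes> v' = e" using w cl by (simp add: v'_def m_assoc)
  note clv = v'[unfolded pfe]
  have "v' \<otimes> u \<ominus> f = \<zero>"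
  proof (rule uniform_left_cancel[OF assms(2) ef(2) _ _ u(2)])
    show "u \<otimes> (v' \<otimes> u \<ominus> f) = \<zero>"
      using cl clv f e uv' by (simp add: minus_eq r_distr r_minus r_neg flip: m_assoc)
    show "f \<otimes> (v' \<otimes> u \<ominus> f) = v' \<otimes> u \<ominus> f"
      using cl clv f e by (simp add: minus_eq r_distr r_minus flip: m_assoc)
  qed (use cl clv f in auto)
  then have "v' \<otimes> u = f" using cl clv f(1) by (metis m_closed r_right_minus_eq)
  then show ?thesis using u(1) v' uv' by auto
qed

end

section \<open>Extension of monomorphisms in right a-rings\<close>

text \<open>
  For injective \<open>j\<close> this is the module structure on the image of \<open>j\<close> that makes \<open>j\<close> an isomorphism.  The
  ring fields \<open>mult\<close> and \<open>one\<close> carry no meaning in a module and get an arbitrary value.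
\<close>

definition copy_rmodule :: "('m \<Rightarrow> 'n) \<Rightarrow> ('a, 'm, 'x) rmodule_scheme \<Rightarrow> ('a, 'n) rmodule" where
  "copy_rmodule j M = \<lparr>carrier = j ` carrier M, monoid.mult = (\<lambda>x y. j \<zero>\<^bsub>M\<^esub>), monoid.one = j \<zero>\<^bsub>M\<^esub>,
     ring.zero = j \<zero>\<^bsub>M\<^esub>, ring.add = (\<lambda>x y. j (inv_into UNIV j x \<oplus>\<^bsub>M\<^esub> inv_into UNIV j y)),
     ract = (\<lambda>x a. j (inv_into UNIV j x \<triangleleft>\<^bsub>M\<^esub> a))\<rparr>"

lemma right_module_copy:
  assumes "right_module R M" "inj j"
  shows "right_module R (copy_rmodule j M)"
proof -
  interpret right_module R M by fact
  have "abelian_group (copy_rmodule j M)"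
  proof (rule abelian_groupI)
    fix x assume "x \<in> carrier (copy_rmodule j M)"
    then obtain x' where "x = j x'" "x' \<in> carrier M" by (auto simp: copy_rmodule_def)
    then show "\<exists>y\<in>carrier (copy_rmodule j M). y \<oplus>\<^bsub>copy_rmodule j M\<^esub> x = \<zero>\<^bsub>copy_rmodule j M\<^esub>"
      using \<open>inj j\<close> by (intro bexI[of _ "j (\<ominus>\<^bsub>M\<^esub> x')"]) (auto simp: copy_rmodule_def M.l_neg)
  qed (use \<open>inj j\<close> in \<open>auto simp: copy_rmodule_def M.a_ac\<close>)
  then show ?thesis
    unfolding right_module_def right_module_axioms_def
    using \<open>inj j\<close> R.ring_axioms
    by (auto simp: copy_rmodule_def ract_closed ract_add_left ract_add_right ract_assoc ract_one)
qed

text \<open>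
  The definition of injectivity tests with modules on the type \<open>'a + 'e\<close>.  Copying along \<open>i\<close> and \<open>j\<close>
  makes it applicable to right ideals of \<open>R\<close> and to \<open>E\<close> itself, through \<open>Inl\<close> and \<open>Inr\<close>.
\<close>

lemma injective_rmodule_extend:
  fixes E :: "('a, 'e, 'y) rmodule_scheme" and R :: "('a, 'r) ring_scheme"
    and A :: "('a, 'm, 'x) rmodule_scheme" and B :: "('a, 'n, 'z) rmodule_scheme"
    and i :: "'m \<Rightarrow> 'a + 'e" and j :: "'n \<Rightarrow> 'a + 'e"
  assumes E: "injective_rmodule R E" and A: "right_module R A" and B: "right_module R B"
    and ij: "inj i" "inj j"
    and g: "g \<in> rmodule_hom R A B" "inj_on g (carrier A)" and h: "h \<in> rmodule_hom R A E"
  shows "\<exists>h'\<in>rmodule_hom R B E. \<forall>x\<in>carrier A. h' (g x) = h x"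
proof -
  let ?A = "copy_rmodule i A" and ?B = "copy_rmodule j B"
  let ?g = "\<lambda>x. j (g (inv_into UNIV i x))" and ?h = "\<lambda>x. h (inv_into UNIV i x)"
  have "right_module R ?A" "right_module R ?B"
    using A B ij by (auto intro: right_module_copy)
  moreover have "?g \<in> rmodule_hom R ?A ?B"
    using g(1) ij by (auto simp: rmodule_hom_def copy_rmodule_def Pi_iff)
  moreover have "inj_on ?g (carrier ?A)"
    using g(2) ij by (auto simp: copy_rmodule_def intro!: inj_onI dest!: injD[OF ij(2)] dest: inj_onD)
  moreover have "?h \<in> rmodule_hom R ?A E"
    using h ij by (auto simp: rmodule_hom_def copy_rmodule_def Pi_iff)
  ultimately obtain k where k: "k \<in> rmodule_hom R ?B E" "\<forall>x\<in>carrier ?A. k (?g x) = ?h x"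
    using E unfolding injective_rmodule_def by blast
  have "(\<lambda>x. k (j x)) \<in> rmodule_hom R B E"
  proof -
    have "k (j (x \<oplus>\<^bsub>B\<^esub> y)) = k (j x) \<oplus>\<^bsub>E\<^esub> k (j y)" if "x \<in> carrier B" "y \<in> carrier B" for x y
    proof -
      have "k (j x \<oplus>\<^bsub>?B\<^esub> j y) = k (j x) \<oplus>\<^bsub>E\<^esub> k (j y)"
        using k(1) that unfolding rmodule_hom_def by (simp add: copy_rmodule_def)
      then show ?thesis using ij by (simp add: copy_rmodule_def)
    qed
    moreover have "k (j (x \<triangleleft>\<^bsub>B\<^esub> a)) = k (j x) \<triangleleft>\<^bsub>E\<^esub> a" if "x \<in> carrier B" "a \<in> carrier R" for x a
    proof -
      have "k (j x \<triangleleft>\<^bsub>?B\<^esub> a) = k (j x) \<triangleleft>\<^bsub>E\<^esub> a"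
        using k(1) that unfolding rmodule_hom_def by (simp add: copy_rmodule_def)
      then show ?thesis using ij by (simp add: copy_rmodule_def)
    qed
    ultimately show ?thesis
      using k(1) by (auto simp: rmodule_hom_def copy_rmodule_def)
  qed
  moreover have "\<forall>x\<in>carrier A. k (j (g x)) = h x"
    using k(2) ij by (auto simp: copy_rmodule_def)
  ultimately show ?thesis by (intro bexI[of _ "\<lambda>x. k (j x)"]) auto
qed

lemma rmodule_homD:
  assumes "h \<in> rmodule_hom R M N"
  shows "\<And>x. x \<in> carrier M \<Longrightarrow> h x \<in> carrier N"
    and "\<And>x y. \<lbrakk>x \<in> carrier M; y \<in> carrier M\<rbrakk> \<Longrightarrow> h (x \<oplus>\<^bsub>M\<^esub> y) = h x \<oplus>\<^bsub>N\<^esub> h y"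
    and "\<And>x a. \<lbrakk>x \<in> carrier M; a \<in> carrier R\<rbrakk> \<Longrightarrow> h (x \<triangleleft>\<^bsub>M\<^esub> a) = h x \<triangleleft>\<^bsub>N\<^esub> a"
  using assms by (auto simp: rmodule_hom_def)

lemma rmodule_hom_zero:
  assumes "right_module R M" "right_module R N" "h \<in> rmodule_hom R M N"
  shows "h \<zero>\<^bsub>M\<^esub> = \<zero>\<^bsub>N\<^esub>"
proof -
  interpret M: right_module R M by fact
  interpret N: right_module R N by fact
  note h = rmodule_homD[OF assms(3)]
  have "h \<zero>\<^bsub>M\<^esub> = h (\<zero>\<^bsub>M\<^esub> \<triangleleft>\<^bsub>M\<^esub> \<zero>\<^bsub>R\<^esub>)" by (simp add: M.ract_zero_left)
  then show ?thesis by (simp add: h N.ract_zero_right)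
qed

lemma rmodule_hom_inj_iff:
  assumes "right_module R M" "right_module R N" "h \<in> rmodule_hom R M N"
  shows "inj_on h (carrier M) \<longleftrightarrow> (\<forall>x\<in>carrier M. h x = \<zero>\<^bsub>N\<^esub> \<longrightarrow> x = \<zero>\<^bsub>M\<^esub>)"
proof
  interpret M: right_module R M by fact
  interpret N: right_module R N by fact
  note h = rmodule_homD[OF assms(3)]
  note z = rmodule_hom_zero[OF assms]
  show "\<forall>x\<in>carrier M. h x = \<zero>\<^bsub>N\<^esub> \<longrightarrow> x = \<zero>\<^bsub>M\<^esub>" if "inj_on h (carrier M)"
    using that z by (metis M.M.zero_closed inj_onD)
  assume k: "\<forall>x\<in>carrier M. h x = \<zero>\<^bsub>N\<^esub> \<longrightarrow> x = \<zero>\<^bsub>M\<^esub>"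
  show "inj_on h (carrier M)"
  proof (rule inj_onI)
    fix x y assume xy: "x \<in> carrier M" "y \<in> carrier M" "h x = h y"
    have "h (x \<oplus>\<^bsub>M\<^esub> \<ominus>\<^bsub>M\<^esub> y) \<oplus>\<^bsub>N\<^esub> h y = h x"
      using xy by (simp add: M.M.a_assoc M.M.l_neg flip: h(2))
    then have "h (x \<oplus>\<^bsub>M\<^esub> \<ominus>\<^bsub>M\<^esub> y) = \<zero>\<^bsub>N\<^esub>"
      using xy h(1) by (metis M.M.add.inv_closed M.M.add.m_closed N.M.add.r_cancel_one)
    then have "x \<oplus>\<^bsub>M\<^esub> \<ominus>\<^bsub>M\<^esub> y = \<zero>\<^bsub>M\<^esub>" using k xy by auto
    then show "x = y" using xy by (metis M.M.minus_equality M.M.minus_minus M.M.add.inv_closed)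
  qed
qed

text \<open>
  Let \<open>E\<close> be an injective envelope of \<open>I\<close>.  It is uniform because \<open>I\<close> is.  By injectivity \<open>h\<close> extends to
  an endomorphism \<open>\<phi>\<close> of \<open>E\<close>; uniformity makes \<open>\<phi>\<close> an automorphism, and then \<open>\<phi>\<close> maps \<open>I\<close> into itself.
\<close>

lemma (in ring) right_a_ring_extend:
  fixes I I' :: "'a set"
  assumes "right_a_ring TYPE('e) R" and I: "uniform_right_ideal R I"
    and I': "right_ideal R I'" "I' \<subseteq> I" "I' \<noteq> {\<zero>}"
    and h: "h \<in> rmodule_hom R ((right_regular R)\<lparr>carrier := I'\<rparr>) ((right_regular R)\<lparr>carrier := I\<rparr>)"
    and inj: "\<And>x. \<lbrakk>x \<in> I'; h x = \<zero>\<rbrakk> \<Longrightarrow> x = \<zero>"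
  shows "\<exists>g\<in>rmodule_hom R ((right_regular R)\<lparr>carrier := I\<rparr>) ((right_regular R)\<lparr>carrier := I\<rparr>).
    \<forall>x\<in>I'. g x = h x"
proof -
  let ?I = "(right_regular R)\<lparr>carrier := I\<rparr>" and ?I' = "(right_regular R)\<lparr>carrier := I'\<rparr>"
  have [simp]: "\<zero>\<^bsub>right_regular R\<^esub> = \<zero>" "add (right_regular R) = add R" "ract (right_regular R) = monoid.mult R"
    by (auto simp: right_regular_def)
  have Ii: "right_ideal R I" using I by (simp add: uniform_right_ideal_def)
  then obtain E :: "('a, 'e) rmodule" and \<iota> where env: "injective_envelope R ?I E \<iota>"
    and inv: "\<And>\<phi>. \<phi> \<in> rmodule_aut R E \<Longrightarrow> \<phi> ` (\<iota> ` I) \<subseteq> \<iota> ` I"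
    using assms(1) unfolding right_a_ring_def automorphism_invariant_def by force
  then have injE: "injective_rmodule R E" and \<iota>: "\<iota> \<in> rmodule_hom R ?I E" "inj_on \<iota> I"
    and ess: "essential_in R E (\<iota> ` I)"
    by (auto simp: injective_envelope_def)
  have E: "right_module R E" using injE by (simp add: injective_rmodule_def)
  have mI: "right_module R ?I" "right_module R ?I'"
    using Ii I'(1) by (auto intro: right_ideal_right_module)
  interpret E: right_module R E by fact
  note \<iota>D = rmodule_homD[OF \<iota>(1), simplified]
  note hD = rmodule_homD[OF h, simplified]
  have \<iota>0: "\<iota> \<zero> = \<zero>\<^bsub>E\<^esub>" using rmodule_hom_zero[OF mI(1) E \<iota>(1)] by simp
  have \<iota>z: "\<iota> x = \<zero>\<^bsub>E\<^esub> \<longleftrightarrow> x = \<zero>" if "x \<in> I" for x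
    using that \<iota>0 \<iota>(2) right_idealD(2)[OF Ii] by (metis inj_onD)
  have pre: "right_ideal R {x\<in>I. \<iota> x \<in> K}" "{x\<in>I. \<iota> x \<in> K} \<noteq> {\<zero>}"
    if K: "rsubmodule R E K" "K \<noteq> {\<zero>\<^bsub>E\<^esub>}" for K
  proof -
    show "right_ideal R {x\<in>I. \<iota> x \<in> K}"
      using K(1) Ii \<iota>D \<iota>0 by (auto simp: right_ideal_iff E.rsubmodule_iff)
    have "\<iota> ` I \<inter> K \<noteq> {\<zero>\<^bsub>E\<^esub>}" using ess K by (simp add: essential_in_def)
    moreover have "\<iota> ` I \<inter> K = \<iota> ` {x\<in>I. \<iota> x \<in> K}" by blast
    ultimately show "{x\<in>I. \<iota> x \<in> K} \<noteq> {\<zero>}" using \<iota>0 by (metis image_empty image_insert)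
  qed
  have uniE: "\<exists>x\<in>I. x \<noteq> \<zero> \<and> \<iota> x \<in> K \<and> x \<in> L"
    if "rsubmodule R E K" "K \<noteq> {\<zero>\<^bsub>E\<^esub>}" "right_ideal R L" "L \<subseteq> I" "L \<noteq> {\<zero>}" for K L
  proof -
    have "{x\<in>I. \<iota> x \<in> K} \<inter> L \<noteq> {\<zero>}"
      using I pre[OF that(1,2)] that(3-5) unfolding uniform_right_ideal_def by blast
    moreover have "right_ideal R ({x\<in>I. \<iota> x \<in> K} \<inter> L)"
      using pre[OF that(1,2)] that(3) by (intro right_ideal_Int) auto
    ultimately obtain x where "x \<in> {x\<in>I. \<iota> x \<in> K} \<inter> L" "x \<noteq> \<zero>" by (metis right_ideal_nonzeroE)
    then show ?thesis by auto
  qed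
  have ker: "rsubmodule R E {x\<in>carrier E. \<psi> x = \<zero>\<^bsub>E\<^esub>}" if "\<psi> \<in> rmodule_hom R E E" for \<psi>
    unfolding E.rsubmodule_iff
    using rmodule_homD[OF that] rmodule_hom_zero[OF E E that]
    by (auto simp: E.ract_closed E.ract_zero_left)
  have sub: "I' \<subseteq> I" by fact
  have "\<iota> \<in> rmodule_hom R ?I' E" "inj_on \<iota> (carrier ?I')"
    using \<iota> \<iota>D subsetD[OF sub] by (auto simp: rmodule_hom_def intro: inj_on_subset)
  moreover have "(\<lambda>x. \<iota> (h x)) \<in> rmodule_hom R ?I' E"
    using \<iota>D hD by (auto simp: rmodule_hom_def)
  ultimately obtain \<phi> where \<phi>: "\<phi> \<in> rmodule_hom R E E" "\<forall>x\<in>I'. \<phi> (\<iota> x) = \<iota> (h x)"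
    using injective_rmodule_extend[OF injE mI(2) E inj_Inl inj_Inr, of \<iota> "\<lambda>x. \<iota> (h x)"] by auto
  note \<phi>D = rmodule_homD[OF \<phi>(1)]
  \<comment> \<open>A nonzero kernel of \<open>\<phi>\<close> would meet \<open>I'\<close>, on which \<open>\<phi>\<close> is the injective map \<open>h\<close>.\<close>
  have "{x\<in>carrier E. \<phi> x = \<zero>\<^bsub>E\<^esub>} = {\<zero>\<^bsub>E\<^esub>}"
  proof (rule ccontr)
    assume "\<not> ?thesis"
    then obtain x where "x \<in> I" "x \<noteq> \<zero>" "\<phi> (\<iota> x) = \<zero>\<^bsub>E\<^esub>" "x \<in> I'"
      using uniE[OF ker[OF \<phi>(1)] _ I'] by auto
    then show False using \<phi>(2) \<iota>z hD(1) inj by auto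
  qed
  then have \<phi>inj: "inj_on \<phi> (carrier E)"
    unfolding rmodule_hom_inj_iff[OF E E \<phi>(1)] by auto
  have "id \<in> rmodule_hom R E E" by (auto simp: rmodule_hom_def)
  then obtain \<psi> where \<psi>: "\<psi> \<in> rmodule_hom R E E" "\<forall>x\<in>carrier E. \<psi> (\<phi> x) = id x"
    using injective_rmodule_extend[OF injE E E inj_Inr inj_Inr \<phi>(1) \<phi>inj, of id] by blast
  note \<psi>D = rmodule_homD[OF \<psi>(1)]
  \<comment> \<open>The kernel of the retraction \<open>\<psi>\<close> of \<open>\<phi>\<close> meets the image of \<open>\<phi>\<close> trivially.  As \<open>h I'\<close> is a nonzero
    submodule of this image, uniformity makes \<open>\<psi>\<close> injective, and then \<open>\<phi>\<close> is surjective.\<close>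
  have "{x\<in>carrier E. \<psi> x = \<zero>\<^bsub>E\<^esub>} = {\<zero>\<^bsub>E\<^esub>}"
  proof (rule ccontr)
    assume "\<not> ?thesis"
    moreover have hI: "right_ideal R (h ` I')"
    proof -
      have "h \<zero> = \<zero>" using rmodule_hom_zero[OF mI(2,1) h] by simp
      then show ?thesis
        unfolding right_ideal_iff
        using hD I'(1) Ii by (auto simp: right_ideal_iff image_iff) (metis hD(2,3))+
    qed
    moreover have "h ` I' \<noteq> {\<zero>}"
      using I'(1,3) inj by (metis imageI right_ideal_nonzeroE singletonD)
    moreover have "h ` I' \<subseteq> I" using hD(1) by auto
    ultimately obtain y where y: "y \<in> h ` I'" "y \<noteq> \<zero>" "\<psi> (\<iota> y) = \<zero>\<^bsub>E\<^esub>"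
      using uniE[OF ker[OF \<psi>(1)], of "h ` I'"] by blast
    then obtain x where x: "x \<in> I'" "\<psi> (\<iota> (h x)) = \<zero>\<^bsub>E\<^esub>" "h x \<noteq> \<zero>" by blast
    then have x0: "x \<noteq> \<zero>" using rmodule_hom_zero[OF mI(2,1) h] by auto
    have "\<psi> (\<phi> (\<iota> x)) = \<zero>\<^bsub>E\<^esub>" using \<phi>(2) x by simp
    then have "\<iota> x = \<zero>\<^bsub>E\<^esub>" using \<psi>(2) x sub \<iota>D(1) by auto
    then show False using x x0 sub \<iota>z by auto
  qed
  then have \<psi>inj: "inj_on \<psi> (carrier E)"
    unfolding rmodule_hom_inj_iff[OF E E \<psi>(1)] by auto
  have "\<phi> (\<psi> x) = x" if "x \<in> carrier E" for x
  proof (rule inj_onD[OF \<psi>inj])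
    show "\<psi> (\<phi> (\<psi> x)) = \<psi> x" using \<psi>(2) \<psi>D(1)[OF that] by simp
    show "\<phi> (\<psi> x) \<in> carrier E" using \<phi>D(1)[OF \<psi>D(1)[OF that]] .
  qed fact
  then have "bij_betw \<phi> (carrier E) (carrier E)"
    using \<phi>D(1) \<psi>D(1) \<psi>(2) by (intro bij_betwI[of _ _ _ \<psi>]) auto
  then have "\<phi> \<in> rmodule_aut R E" using \<phi>(1) by (simp add: rmodule_aut_def)
  then have \<phi>I: "\<exists>y\<in>I. \<phi> (\<iota> x) = \<iota> y" if "x \<in> I" for x using inv[of \<phi>] that by auto
  define g where "g x = (THE y. y \<in> I \<and> \<phi> (\<iota> x) = \<iota> y)" for x
  have gI: "g x = y" if "y \<in> I" "\<phi> (\<iota> x) = \<iota> y" for x y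
    unfolding g_def using that \<iota>(2) by (intro the_equality) (auto dest: inj_onD)
  have g: "g x \<in> I" "\<phi> (\<iota> x) = \<iota> (g x)" if "x \<in> I" for x
    using \<phi>I[OF that] gI by auto
  have "g \<in> rmodule_hom R ?I ?I"
  proof -
    have "g (x \<oplus> y) = g x \<oplus> g y" if "x \<in> I" "y \<in> I" for x y
      using that g right_idealD(3)[OF Ii] \<iota>D \<phi>D by (intro gI) auto
    moreover have "g (x \<otimes> a) = g x \<otimes> a" if "x \<in> I" "a \<in> carrier R" for x a
      using that g right_idealD(4)[OF Ii] \<iota>D \<phi>D by (intro gI) auto
    ultimately show ?thesis using g by (auto simp: rmodule_hom_def)
  qed
  moreover have "\<forall>x\<in>I'. g x = h x"
    using \<phi>(2) hD(1) gI by auto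
  ultimately show ?thesis by auto
qed

section \<open>Peirce components are one-dimensional\<close>

lemma opposite_ring_ring:
  assumes "ring R" shows "ring (opposite_ring R)"
proof -
  interpret ring R by fact
  have "abelian_group (opposite_ring R)"
    by (rule abelian_groupI) (auto simp: opposite_ring_def a_ac intro: add.l_inv_ex)
  then show ?thesis
    by (rule ringI) (auto simp: opposite_ring_def l_distr r_distr m_assoc intro!: monoidI)
qed

context ring
begin

lemma uniform_left_inj:
  assumes "right_nonsingular R" "uniform_idempotent R e" "a \<in> carrier R" "a \<otimes> e = a" "a \<noteq> \<zero>"
    and "x \<in> carrier R" "e \<otimes> x = x" "y \<in> carrier R" "e \<otimes> y = y" "a \<otimes> x = a \<otimes> y"
  shows "x = y"
proof -
  have ec: "e \<in> carrier R" using uniform_idempotentD assms(2) by auto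
  have "x \<ominus> y = \<zero>"
    by (rule uniform_left_cancel[OF assms(1-5)])
      (use assms(3,6-) ec in \<open>auto simp: minus_eq r_distr r_minus r_neg\<close>)
  then show ?thesis using assms(6,8) by (metis r_right_minus_eq)
qed

lemma uniform_right_ideal_subset:
  assumes "uniform_right_ideal R I" "right_ideal R J" "J \<subseteq> I" "J \<noteq> {\<zero>}"
  shows "uniform_right_ideal R J"
proof -
  have "K \<inter> L \<noteq> {\<zero>}"
    if "right_ideal R K" "K \<subseteq> J" "K \<noteq> {\<zero>}" "right_ideal R L" "L \<subseteq> J" "L \<noteq> {\<zero>}" for K L
    using assms(1,3) that unfolding uniform_right_ideal_def by (meson subset_trans)
  then show ?thesis using assms(2,4) by (simp add: uniform_right_ideal_def)
qed

text \<open>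
  For nonzero \<open>a, b \<in> R f\<close> the correspondence \<open>a x \<mapsto> b x\<close> is a well-defined monomorphism, since
  both left multiplications are injective on \<open>f R\<close>; wherever source and target lie in a uniform
  right ideal \<open>I\<close>, it extends to an endomorphism of \<open>I\<close>.
\<close>

lemma uniform_transfer:
  assumes ns: "right_nonsingular R" and ar: "right_a_ring TYPE('e) R"
    and f: "uniform_idempotent R f"
    and a: "a \<in> carrier R" "a \<otimes> f = a" "a \<noteq> \<zero>" and b: "b \<in> carrier R" "b \<otimes> f = b" "b \<noteq> \<zero>"
    and I: "uniform_right_ideal R I" and Y: "right_ideal R Y" "Y \<noteq> {\<zero>}"
    and YD: "\<And>x. x \<in> Y \<Longrightarrow> f \<otimes> x = x" "\<And>x. x \<in> Y \<Longrightarrow> a \<otimes> x \<in> I" "\<And>x. x \<in> Y \<Longrightarrow> b \<otimes> x \<in> I"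
  obtains g where "\<And>z. z \<in> I \<Longrightarrow> g z \<in> I" "\<And>z r. \<lbrakk>z \<in> I; r \<in> carrier R\<rbrakk> \<Longrightarrow> g (z \<otimes> r) = g z \<otimes> r"
    "\<And>x. x \<in> Y \<Longrightarrow> g (a \<otimes> x) = b \<otimes> x"
proof -
  have [simp]: "\<zero>\<^bsub>right_regular R\<^esub> = \<zero>" "add (right_regular R) = add R" "ract (right_regular R) = monoid.mult R"
    by (auto simp: right_regular_def)
  note xc = right_idealD[OF Y(1)]
  define h where "h z = b \<otimes> (THE x. x \<in> Y \<and> a \<otimes> x = z)" for z
  have h: "h (a \<otimes> x) = b \<otimes> x" if "x \<in> Y" for x
  proof -
    have "(THE x'. x' \<in> Y \<and> a \<otimes> x' = a \<otimes> x) = x"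
      using that YD(1) xc(1) by (intro the_equality) (auto intro: uniform_left_inj[OF ns f a])
    then show ?thesis by (simp add: h_def)
  qed
  let ?J = "(\<lambda>x. a \<otimes> x) ` Y"
  have J: "right_ideal R ?J" using Y(1) a(1) by (rule right_ideal_image)
  have JI: "?J \<subseteq> I" using YD(2) by auto
  obtain x0 where x0: "x0 \<in> Y" "x0 \<noteq> \<zero>" using Y by (rule right_ideal_nonzeroE)
  then have "a \<otimes> x0 \<noteq> \<zero>" using uniform_left_cancel[OF ns f a, of x0] xc(1) YD(1) by auto
  then have J0: "?J \<noteq> {\<zero>}" using x0 by auto
  have hom: "h \<in> rmodule_hom R ((right_regular R)\<lparr>carrier := ?J\<rparr>) ((right_regular R)\<lparr>carrier := I\<rparr>)"
  proof -
    have "h (a \<otimes> x \<oplus> a \<otimes> y) = h (a \<otimes> x) \<oplus> h (a \<otimes> y)" if "x \<in> Y" "y \<in> Y" for x y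
      using that h[of "x \<oplus> y"] xc a b by (simp add: h r_distr)
    moreover have "h ((a \<otimes> x) \<otimes> r) = h (a \<otimes> x) \<otimes> r" if "x \<in> Y" "r \<in> carrier R" for x r
      using that h[of "x \<otimes> r"] xc a b by (simp add: h m_assoc)
    ultimately show ?thesis using h YD(3) by (auto simp: rmodule_hom_def)
  qed
  have inj: "z = \<zero>" if z: "z \<in> ?J" "h z = \<zero>" for z
  proof -
    obtain x where x: "x \<in> Y" "z = a \<otimes> x" using z(1) by auto
    then have "b \<otimes> x = \<zero>" using h z(2) by simp
    then have "x = \<zero>" using uniform_left_cancel[OF ns f b, of x] x xc(1) YD(1) by auto
    then show ?thesis using x a(1) by simp
  qed
  obtain g where "g \<in> rmodule_hom R ((right_regular R)\<lparr>carrier := I\<rparr>) ((right_regular R)\<lparr>carrier := I\<rparr>)"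
    "\<forall>z\<in>?J. g z = h z"
    using right_a_ring_extend[OF ar I J JI J0 hom inj] by auto
  then show ?thesis
    using h by (intro that[of g]) (auto simp: rmodule_hom_def)
qed

text \<open>
  Take \<open>I = e R\<close>: the endomorphism of \<open>e R\<close> that extends \<open>a x \<mapsto> b x\<close> is left multiplication by its value
  at \<open>e\<close>, an element of \<open>e R e\<close>.
\<close>

lemma peirce_left_generated:
  assumes ns: "right_nonsingular R" and ar: "right_a_ring TYPE('e) R"
    and e: "uniform_idempotent R e" and f: "uniform_idempotent R f"
    and a: "a \<in> peirce R e f" "a \<noteq> \<zero>" and b: "b \<in> peirce R e f"
  shows "\<exists>d\<in>peirce R e e. d \<otimes> a = b"
proof (cases "b = \<zero>")
  case True
  have "\<zero> \<in> peirce R e e" using uniform_peirce_iff[OF e e] uniform_idempotentD[OF e] by auto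
  then show ?thesis using True a uniform_peirce_iff[OF e f] by (intro bexI[of _ \<zero>]) auto
next
  case False
  note eD = uniform_idempotentD[OF e] and fD = uniform_idempotentD[OF f]
  note ac = a(1)[unfolded uniform_peirce_iff[OF e f]] and bc = b[unfolded uniform_peirce_iff[OF e f]]
  note ei = principal_idempotent_iff[OF eD(1,2)] and fi = principal_idempotent_iff[OF fD(1,2)]
  obtain g where g: "\<And>z. z \<in> principal_right_ideal R e \<Longrightarrow> g z \<in> principal_right_ideal R e"
    "\<And>z r. \<lbrakk>z \<in> principal_right_ideal R e; r \<in> carrier R\<rbrakk> \<Longrightarrow> g (z \<otimes> r) = g z \<otimes> r"
    "\<And>x. x \<in> principal_right_ideal R f \<Longrightarrow> g (a \<otimes> x) = b \<otimes> x"
  proof (rule uniform_transfer[OF ns ar f, of a b "principal_right_ideal R e" "principal_right_ideal R f"])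
    show "uniform_right_ideal R (principal_right_ideal R e)" using e by (simp add: uniform_idempotent_def)
    show "principal_right_ideal R f \<noteq> {\<zero>}" using principal_right_ideal_self[OF fD(1)] fD(3) by auto
    fix x assume "x \<in> principal_right_ideal R f"
    then have x: "x \<in> carrier R" "f \<otimes> x = x" by (auto simp: fi)
    then show "f \<otimes> x = x" by simp
    show "a \<otimes> x \<in> principal_right_ideal R e" "b \<otimes> x \<in> principal_right_ideal R e"
      using ac bc x eD by (auto simp: ei simp flip: m_assoc)
  qed (use ac bc a(2) False fD right_ideal_principal in auto)
  have ge: "g e \<in> carrier R" "e \<otimes> g e = g e" using g(1)[of e] eD by (auto simp: ei)
  have "g e \<otimes> e = g (e \<otimes> e)" using g(2)[of e e] eD by (auto simp: ei)
  then have "g e \<in> peirce R e e" using ge eD uniform_peirce_iff[OF e e] by auto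
  moreover have "g e \<otimes> a = b"
  proof -
    have "g e \<otimes> a = g (e \<otimes> a)" using g(2)[of e a] eD ac by (auto simp: ei)
    also have "\<dots> = g (a \<otimes> f)" using ac by simp
    also have "\<dots> = b" using g(3)[of f] fD bc by (simp add: fi)
    finally show ?thesis .
  qed
  ultimately show ?thesis by auto
qed

text \<open>
  Here the correspondence \<open>a x \<mapsto> b x\<close> is restricted to those \<open>x\<close> with \<open>b x \<in> a R\<close> and extended to
  an endomorphism \<open>g\<close> of \<open>a R\<close>.  Since \<open>g a - b\<close> annihilates such an \<open>x \<noteq> 0\<close>, cancellation
  gives \<open>b = g a \<in> a R\<close>.
\<close>

lemma peirce_right_generated:
  assumes ns: "right_nonsingular R" and ar: "right_a_ring TYPE('e) R"
    and e: "uniform_idempotent R e" and f: "uniform_idempotent R f"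
    and a: "a \<in> peirce R e f" "a \<noteq> \<zero>" and b: "b \<in> peirce R e f"
  shows "\<exists>d\<in>peirce R f f. a \<otimes> d = b"
proof (cases "b = \<zero>")
  case True
  have "\<zero> \<in> peirce R f f" using uniform_peirce_iff[OF f f] uniform_idempotentD[OF f] by auto
  then show ?thesis using True a uniform_peirce_iff[OF e f] by (intro bexI[of _ \<zero>]) auto
next
  case False
  note eD = uniform_idempotentD[OF e] and fD = uniform_idempotentD[OF f]
  note ac = a(1)[unfolded uniform_peirce_iff[OF e f]] and bc = b[unfolded uniform_peirce_iff[OF e f]]
  note ei = principal_idempotent_iff[OF eD(1,2)]
  have ue: "uniform_right_ideal R (principal_right_ideal R e)" using e by (simp add: uniform_idempotent_def)
  have sub: "principal_right_ideal R c \<subseteq> principal_right_ideal R e" "principal_right_ideal R c \<noteq> {\<zero>}"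
    if "c \<in> carrier R" "e \<otimes> c = c" "c \<noteq> \<zero>" for c
  proof -
    show "principal_right_ideal R c \<subseteq> principal_right_ideal R e"
      using that eD by (auto simp: principal_right_ideal_def ei[unfolded principal_right_ideal_def] simp flip: m_assoc)
    show "principal_right_ideal R c \<noteq> {\<zero>}" using principal_right_ideal_self that by auto
  qed
  note aR = sub[of a] and bR = sub[of b]
  have ai: "right_ideal R (principal_right_ideal R a)" and bi: "right_ideal R (principal_right_ideal R b)"
    using ac bc by (auto intro: right_ideal_principal)
  define Y where "Y = {x \<in> carrier R. f \<otimes> x = x \<and> b \<otimes> x \<in> principal_right_ideal R a}"
  have Y: "right_ideal R Y"
    using fD bc right_idealD[OF ai]
    by (auto simp: right_ideal_iff Y_def r_distr simp flip: m_assoc)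
  have "principal_right_ideal R a \<inter> principal_right_ideal R b \<noteq> {\<zero>}"
    using ue ai bi aR bR ac bc a(2) False unfolding uniform_right_ideal_def by blast
  then obtain y where "y \<in> principal_right_ideal R a \<inter> principal_right_ideal R b" "y \<noteq> \<zero>"
    using right_ideal_Int[OF ai bi] by (metis right_ideal_nonzeroE)
  then obtain x where x: "x \<in> carrier R" "b \<otimes> x \<in> principal_right_ideal R a" "b \<otimes> x \<noteq> \<zero>"
    by (auto simp: principal_right_ideal_def[of R b])
  have "b \<otimes> (f \<otimes> x) = b \<otimes> x" using bc fD x(1) by (simp flip: m_assoc)
  then have x': "f \<otimes> x \<in> Y" "f \<otimes> x \<noteq> \<zero>"
    using x fD bc by (auto simp: Y_def) (simp flip: m_assoc)
  obtain g where g: "\<And>z. z \<in> principal_right_ideal R a \<Longrightarrow> g z \<in> principal_right_ideal R a"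
    "\<And>z r. \<lbrakk>z \<in> principal_right_ideal R a; r \<in> carrier R\<rbrakk> \<Longrightarrow> g (z \<otimes> r) = g z \<otimes> r"
    "\<And>x. x \<in> Y \<Longrightarrow> g (a \<otimes> x) = b \<otimes> x"
  proof (rule uniform_transfer[OF ns ar f, of a b "principal_right_ideal R a" Y])
    show "uniform_right_ideal R (principal_right_ideal R a)"
      using uniform_right_ideal_subset[OF ue ai] aR ac a(2) by auto
    fix x assume "x \<in> Y"
    then show "a \<otimes> x \<in> principal_right_ideal R a"
      by (auto simp: Y_def principal_right_ideal_def)
  qed (use ac bc a(2) False Y x' in \<open>auto simp: Y_def\<close>)
  have aa: "a \<in> principal_right_ideal R a" using ac principal_right_ideal_self by simp
  have ga: "g a \<in> carrier R" using right_idealD(1)[OF ai] g(1)[OF aa] by simp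
  have gaf: "g a \<otimes> f = g a" using g(2)[OF aa fD(1)] ac by simp
  have "g a \<ominus> b = \<zero>"
  proof (rule ccontr)
    assume ne: "g a \<ominus> b \<noteq> \<zero>"
    have "(g a \<ominus> b) \<otimes> (f \<otimes> x) = g (a \<otimes> (f \<otimes> x)) \<ominus> b \<otimes> (f \<otimes> x)"
      using g(2)[OF aa, of "f \<otimes> x"] ga bc fD x(1) by (simp add: minus_eq l_distr l_minus)
    also have "\<dots> = \<zero>" using g(3)[OF x'(1)] bc x(1) fD by (simp add: minus_eq r_neg)
    finally have "(g a \<ominus> b) \<otimes> (f \<otimes> x) = \<zero>" .
    moreover have "(g a \<ominus> b) \<otimes> f = g a \<ominus> b"
      using ga gaf bc fD by (simp add: minus_eq l_distr l_minus)
    moreover have "f \<otimes> (f \<otimes> x) = f \<otimes> x" using fD x(1) by (simp flip: m_assoc)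
    ultimately have "f \<otimes> x = \<zero>"
      using uniform_left_cancel[OF ns f _ _ ne] ga bc fD x(1) by simp
    then show False using x' by simp
  qed
  then have "b = g a" using ga bc by (metis r_right_minus_eq)
  then obtain c where c: "c \<in> carrier R" "b = a \<otimes> c"
    using g(1)[OF aa] by (auto simp: principal_right_ideal_def)
  have "a \<otimes> (f \<otimes> c \<otimes> f) = (a \<otimes> f) \<otimes> c \<otimes> f"
    using ac[THEN conjunct1] c(1) fD(1) by (simp add: m_assoc)
  also have "\<dots> = b" using ac c(2) bc by simp
  finally show ?thesis using c(1) by (intro bexI[of _ "f \<otimes> c \<otimes> f"]) (auto simp: peirce_def)
qed

lemma corner_ring_ring:
  assumes "e \<in> carrier R" "e \<otimes> e = e"
  shows "ring (corner_ring R e)"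
proof -
  let ?S = "corner_ring R e"
  have p: "carrier ?S = {x \<in> carrier R. e \<otimes> x = x \<and> x \<otimes> e = x}"
    using peirce_iff[OF assms assms] by (auto simp: corner_ring_def)
  have [simp]: "monoid.mult ?S = monoid.mult R" "add ?S = add R" "\<zero>\<^bsub>?S\<^esub> = \<zero>" "\<one>\<^bsub>?S\<^esub> = e"
    by (auto simp: corner_ring_def)
  have m: "e \<otimes> (x \<otimes> y) = (e \<otimes> x) \<otimes> y" "(x \<otimes> y) \<otimes> e = x \<otimes> (y \<otimes> e)"
    if "x \<in> carrier R" "y \<in> carrier R" for x y
    using that assms by (auto simp: m_assoc)
  show ?thesis
  proof (rule ringI)
    show "abelian_group ?S"
    proof (rule abelian_groupI)
      fix x assume x: "x \<in> carrier ?S"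
      then show "\<exists>y\<in>carrier ?S. y \<oplus>\<^bsub>?S\<^esub> x = \<zero>\<^bsub>?S\<^esub>"
        using assms by (intro bexI[of _ "\<ominus> x"]) (auto simp: p l_neg r_minus l_minus)
    qed (use assms in \<open>auto simp: p r_distr l_distr a_ac\<close>)
    show "monoid ?S"
    proof (rule monoidI)
      fix x y z assume "x \<in> carrier ?S" "y \<in> carrier ?S" "z \<in> carrier ?S"
      then show "x \<otimes>\<^bsub>?S\<^esub> y \<otimes>\<^bsub>?S\<^esub> z = x \<otimes>\<^bsub>?S\<^esub> (y \<otimes>\<^bsub>?S\<^esub> z)" by (auto simp: p m_assoc)
    qed (use assms m in \<open>auto simp: p\<close>)
  qed (auto simp: p l_distr r_distr)
qed

lemma corner_is_division_ring:
  assumes "right_artinian R" "right_nonsingular R" "uniform_idempotent R e"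
  shows "is_division_ring (corner_ring R e)"
proof -
  note e = uniform_idempotentD[OF assms(3)]
  have "Units (corner_ring R e) = carrier (corner_ring R e) - {\<zero>\<^bsub>corner_ring R e\<^esub>}"
  proof (intro equalityI subsetI)
    fix x assume "x \<in> Units (corner_ring R e)"
    then obtain y where "x \<in> peirce R e e" "y \<in> peirce R e e" "y \<otimes> x = e"
      by (auto simp: Units_def corner_ring_def)
    then show "x \<in> carrier (corner_ring R e) - {\<zero>\<^bsub>corner_ring R e\<^esub>}"
      using e uniform_peirce_iff[OF assms(3,3)] by (auto simp: corner_ring_def)
  next
    fix x assume "x \<in> carrier (corner_ring R e) - {\<zero>\<^bsub>corner_ring R e\<^esub>}"
    then have x: "x \<in> peirce R e e" "x \<noteq> \<zero>" by (auto simp: corner_ring_def)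
    then show "x \<in> Units (corner_ring R e)"
      using uniform_corner_inverse[OF assms x] by (auto simp: Units_def corner_ring_def)
  qed
  then show ?thesis
    using corner_ring_ring[OF e(1,2)] e(3) by (simp add: is_division_ring_def) (simp add: corner_ring_def)
qed

text \<open>A generator \<open>a\<close> of \<open>e R f\<close> on both sides identifies \<open>c \<in> e R e\<close> with the \<open>d \<in> f R f\<close> such that \<open>c a = a d\<close>.\<close>

lemma corner_ring_iso:
  assumes ns: "right_nonsingular R" and ar: "right_a_ring TYPE('e) R"
    and e: "uniform_idempotent R e" and f: "uniform_idempotent R f"
    and ne: "peirce R e f \<noteq> {\<zero>}"
  shows "corner_ring R e \<simeq> corner_ring R f"
proof -
  note eD = uniform_idempotentD[OF e] and fD = uniform_idempotentD[OF f]
  note pef = uniform_peirce_iff[OF e f] and pee = uniform_peirce_iff[OF e e] and pff = uniform_peirce_iff[OF f f]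
  have "\<zero> \<in> peirce R e f" using eD fD by (simp add: pef)
  then obtain a where a: "a \<in> peirce R e f" "a \<noteq> \<zero>" using ne by blast
  note ac = a(1)[unfolded pef]
  define s where "s c = (THE d. d \<in> peirce R f f \<and> a \<otimes> d = c \<otimes> a)" for c
  have sI: "s c = d" if "d \<in> peirce R f f" "a \<otimes> d = c \<otimes> a" for c d
    unfolding s_def
    using that ac by (intro the_equality) (auto simp: pff intro: uniform_left_inj[OF ns f _ _ a(2)])
  have s: "s c \<in> peirce R f f \<and> a \<otimes> s c = c \<otimes> a" if "c \<in> peirce R e e" for c
  proof -
    have "c \<otimes> a \<in> peirce R e f" using peirce_mult_closed[OF e e f that a(1)] .
    then obtain d where "d \<in> peirce R f f" "a \<otimes> d = c \<otimes> a"
      using peirce_right_generated[OF ns ar e f a] by auto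
    then show ?thesis using sI by simp
  qed
  have "s (c \<otimes> d) = s c \<otimes> s d" if "c \<in> peirce R e e" "d \<in> peirce R e e" for c d
  proof (rule sI)
    note sc = s[OF that(1)] s[OF that(2)]
    show "s c \<otimes> s d \<in> peirce R f f" using sc peirce_mult_closed[OF f f f] by simp
    note cl = sc[unfolded pff] ac that[unfolded pee]
    have "a \<otimes> (s c \<otimes> s d) = (a \<otimes> s c) \<otimes> s d" by (rule m_assoc[symmetric]) (use cl in auto)
    also have "\<dots> = (c \<otimes> a) \<otimes> s d" using sc by simp
    also have "\<dots> = c \<otimes> (a \<otimes> s d)" by (rule m_assoc) (use cl in auto)
    also have "\<dots> = c \<otimes> (d \<otimes> a)" using sc by simp
    also have "\<dots> = c \<otimes> d \<otimes> a" by (rule m_assoc[symmetric]) (use cl in auto)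
    finally show "a \<otimes> (s c \<otimes> s d) = c \<otimes> d \<otimes> a" .
  qed
  moreover have "s (c \<oplus> d) = s c \<oplus> s d" if "c \<in> peirce R e e" "d \<in> peirce R e e" for c d
  proof (rule sI)
    note sc = s[OF that(1)] s[OF that(2)]
    show "s c \<oplus> s d \<in> peirce R f f" using sc peirce_add_closed[OF f f] by simp
    show "a \<otimes> (s c \<oplus> s d) = (c \<oplus> d) \<otimes> a" using sc ac that by (auto simp: pff pee l_distr r_distr)
  qed
  moreover have "s e = f" using ac fD eD by (intro sI) (auto simp: pff)
  moreover have "bij_betw s (peirce R e e) (peirce R f f)"
  proof (rule bij_betw_imageI)
    show "inj_on s (peirce R e e)"
    proof (rule inj_onI)
      fix c d assume cd: "c \<in> peirce R e e" "d \<in> peirce R e e" "s c = s d"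
      then have "c \<otimes> a = d \<otimes> a" using s by metis
      then have "(c \<ominus> d) \<otimes> a = \<zero>" using cd ac by (simp add: pee minus_eq l_distr l_minus r_neg)
      then have "c \<ominus> d = \<zero>"
        using uniform_left_cancel[OF ns e, of "c \<ominus> d" a] cd ac a(2) eD
        by (auto simp: pee minus_eq l_distr l_minus)
      then show "c = d" using cd by (metis pee r_right_minus_eq)
    qed
    show "s ` peirce R e e = peirce R f f"
    proof (intro equalityI subsetI)
      fix d assume d: "d \<in> peirce R f f"
      then have "a \<otimes> d \<in> peirce R e f" using peirce_mult_closed[OF e f f a(1)] by simp
      then obtain c where "c \<in> peirce R e e" "c \<otimes> a = a \<otimes> d"
        using peirce_left_generated[OF ns ar e f a] by auto
      then show "d \<in> s ` peirce R e e" using sI[OF d] by force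
    qed (use s in auto)
  qed
  ultimately have "s \<in> ring_iso (corner_ring R e) (corner_ring R f)"
    using s by (auto simp: ring_iso_def ring_hom_def corner_ring_def)
  then show ?thesis by (auto simp: is_ring_iso_def)
qed

lemma rdim_oneI:
  assumes V: "right_module D V" and a: "a \<in> carrier V"
    and gen: "\<And>v. v \<in> carrier V \<Longrightarrow> \<exists>c\<in>carrier D. v = a \<triangleleft>\<^bsub>V\<^esub> c"
    and free: "\<And>c. \<lbrakk>c \<in> carrier D; a \<triangleleft>\<^bsub>V\<^esub> c = \<zero>\<^bsub>V\<^esub>\<rbrakk> \<Longrightarrow> c = \<zero>\<^bsub>D\<^esub>"
  shows "rdim D V 1"
proof -
  interpret V: right_module D V by fact
  have sum: "(\<Oplus>\<^bsub>V\<^esub>b\<in>{a}. b \<triangleleft>\<^bsub>V\<^esub> c b) = a \<triangleleft>\<^bsub>V\<^esub> c a" if "c \<in> {a} \<rightarrow> carrier D" for c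
    using that a V.ract_closed by (subst V.M.finsum_insert) auto
  have "rbasis D V {a}"
    unfolding rbasis_def
  proof (intro conjI ballI impI)
    fix c b assume c: "c \<in> {a} \<rightarrow> carrier D" "(\<Oplus>\<^bsub>V\<^esub>b\<in>{a}. b \<triangleleft>\<^bsub>V\<^esub> c b) = \<zero>\<^bsub>V\<^esub>" "b \<in> {a}"
    then show "c b = \<zero>\<^bsub>D\<^esub>" using free[of "c a"] sum[OF c(1)] by auto
  next
    fix v assume "v \<in> carrier V"
    then obtain c where c: "c \<in> carrier D" "v = a \<triangleleft>\<^bsub>V\<^esub> c" using gen by blast
    then show "\<exists>c\<in>{a} \<rightarrow> carrier D. v = (\<Oplus>\<^bsub>V\<^esub>b\<in>{a}. b \<triangleleft>\<^bsub>V\<^esub> c b)"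
      using sum[of "\<lambda>_. c"] by (intro bexI[of _ "\<lambda>_. c"]) auto
  qed (use a in auto)
  then show ?thesis using V by (auto simp: rdim_def intro!: exI[of _ "{a}"])
qed

lemma peirce_abelian_group:
  assumes "e \<in> carrier R" "e \<otimes> e = e" "f \<in> carrier R" "f \<otimes> f = f"
    and "carrier M = peirce R e f" "\<zero>\<^bsub>M\<^esub> = \<zero>" "add M = add R"
  shows "abelian_group M"
proof (rule abelian_groupI)
  note p = peirce_iff[OF assms(1-4)]
  fix x assume x: "x \<in> carrier M"
  then have "\<ominus> x \<in> peirce R e f" using assms by (auto simp: p r_minus l_minus)
  then show "\<exists>y\<in>carrier M. y \<oplus>\<^bsub>M\<^esub> x = \<zero>\<^bsub>M\<^esub>"
    using assms(5-) x by (intro bexI[of _ "\<ominus> x"]) (auto simp: p l_neg)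
qed (use assms peirce_iff[OF assms(1-4)] in \<open>auto simp: r_distr l_distr a_ac\<close>)

text \<open>
  Any nonzero \<open>a \<in> e R f\<close> is a basis on either side.  It is free on the right because \<open>a\<close> cancels on
  \<open>f R\<close>, and on the left because every nonzero \<open>c \<in> e R e\<close> cancels on \<open>e R\<close>, which contains \<open>a\<close>.
\<close>

lemma peirce_dims:
  assumes ns: "right_nonsingular R" and ar: "right_a_ring TYPE('e) R"
    and e: "uniform_idempotent R e" and f: "uniform_idempotent R f"
    and ne: "peirce R e f \<noteq> {\<zero>}"
  shows "peirce_left_dim R e f 1" "peirce_right_dim R e f 1"
proof -
  note eD = uniform_idempotentD[OF e] and fD = uniform_idempotentD[OF f]
  note pef = uniform_peirce_iff[OF e f] and pee = uniform_peirce_iff[OF e e] and pff = uniform_peirce_iff[OF f f]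
  have "\<zero> \<in> peirce R e f" using eD fD by (simp add: pef)
  then obtain a where a: "a \<in> peirce R e f" "a \<noteq> \<zero>" using ne by blast
  note ac = a(1)[unfolded pef]
  show "peirce_left_dim R e f 1"
    unfolding peirce_left_dim_def
  proof (rule rdim_oneI)
    let ?M = "(right_regular (opposite_ring R))\<lparr>carrier := peirce R e f\<rparr>"
    have "ring (opposite_ring (corner_ring R e))"
      using opposite_ring_ring[OF corner_ring_ring[OF eD(1,2)]] .
    moreover have "abelian_group ?M"
      using eD fD by (intro peirce_abelian_group[of e f]) (auto simp: right_regular_def opposite_ring_def)
    ultimately show "right_module (opposite_ring (corner_ring R e)) ?M"
      unfolding right_module_def right_module_axioms_def
      using peirce_mult_closed[OF e e f]
      by (auto simp: right_regular_def opposite_ring_def corner_ring_def pef pee l_distr r_distr m_assoc)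
    show "a \<in> carrier ?M" using a by simp
    show "\<exists>c\<in>carrier (opposite_ring (corner_ring R e)). v = a \<triangleleft>\<^bsub>?M\<^esub> c" if "v \<in> carrier ?M" for v
      using peirce_left_generated[OF ns ar e f a, of v] that
      by (auto simp: right_regular_def opposite_ring_def corner_ring_def)
    show "c = \<zero>\<^bsub>opposite_ring (corner_ring R e)\<^esub>"
      if "c \<in> carrier (opposite_ring (corner_ring R e))" "a \<triangleleft>\<^bsub>?M\<^esub> c = \<zero>\<^bsub>?M\<^esub>" for c
      using uniform_left_cancel[OF ns e, of c a] that ac a(2)
      by (auto simp: right_regular_def opposite_ring_def corner_ring_def pee)
  qed
  show "peirce_right_dim R e f 1"
    unfolding peirce_right_dim_def
  proof (rule rdim_oneI)
    let ?M = "(right_regular R)\<lparr>carrier := peirce R e f\<rparr>"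
    have "ring (corner_ring R f)"
      using corner_ring_ring[OF fD(1,2)] .
    moreover have "abelian_group ?M"
      using eD fD by (intro peirce_abelian_group[of e f]) (auto simp: right_regular_def)
    ultimately show "right_module (corner_ring R f) ?M"
      unfolding right_module_def right_module_axioms_def
      using peirce_mult_closed[OF e f f]
      by (auto simp: right_regular_def corner_ring_def pef pff l_distr r_distr m_assoc)
    show "a \<in> carrier ?M" using a by simp
    show "\<exists>c\<in>carrier (corner_ring R f). v = a \<triangleleft>\<^bsub>?M\<^esub> c" if "v \<in> carrier ?M" for v
      using peirce_right_generated[OF ns ar e f a, of v] that
      by (auto simp: right_regular_def corner_ring_def)
    show "c = \<zero>\<^bsub>corner_ring R f\<^esub>"
      if "c \<in> carrier (corner_ring R f)" "a \<triangleleft>\<^bsub>?M\<^esub> c = \<zero>\<^bsub>?M\<^esub>" for c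
      using uniform_left_cancel[OF ns f, of a c] that ac a(2)
      by (auto simp: right_regular_def corner_ring_def pff)
  qed
qed

end

section \<open>Matrix representation\<close>

context ring
begin

lemma finsum_single:
  assumes "finite A" "i \<in> A" "f \<in> A \<rightarrow> carrier R" "\<And>j. j \<in> A \<Longrightarrow> j \<noteq> i \<Longrightarrow> f j = \<zero>"
  shows "finsum R f A = f i"
proof -
  have "finsum R f A = (\<Oplus>j\<in>A. if i = j then f j else \<zero>)"
    using assms by (intro finsum_cong') auto
  then show ?thesis using add.finprod_singleton[OF assms(2,1,3)] by simp
qed

lemma finsum_Sigma:
  assumes "finite A" "\<And>i. i \<in> A \<Longrightarrow> finite (B i)" "\<And>i j. i \<in> A \<Longrightarrow> j \<in> B i \<Longrightarrow> f i j \<in> carrier R"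
  shows "(\<Oplus>i\<in>A. \<Oplus>j\<in>B i. f i j) = (\<Oplus>p\<in>Sigma A B. f (fst p) (snd p))"
proof -
  have "(\<Oplus>p\<in>Sigma A B. f (fst p) (snd p)) = (\<Oplus>p\<in>(\<Union>i\<in>A. Pair i ` B i). f (fst p) (snd p))"
    by (rule arg_cong[where f = "finsum R _"]) auto
  also have "\<dots> = (\<Oplus>i\<in>A. \<Oplus>p\<in>Pair i ` B i. f (fst p) (snd p))"
    by (rule add.finprod_UN_disjoint) (use assms in \<open>auto simp: pairwise_def disjnt_def\<close>)
  also have "\<dots> = (\<Oplus>i\<in>A. \<Oplus>j\<in>B i. f i j)"
  proof (rule finsum_cong')
    fix i assume i: "i \<in> A"
    have "(\<Oplus>p\<in>Pair i ` B i. f (fst p) (snd p)) = (\<Oplus>j\<in>B i. f (fst (i, j)) (snd (i, j)))"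
      by (rule add.finprod_reindex) (use assms i in \<open>auto intro: inj_onI\<close>)
    then show "(\<Oplus>p\<in>Pair i ` B i. f (fst p) (snd p)) = (\<Oplus>j\<in>B i. f i j)" by simp
  qed (use assms in auto)
  finally show ?thesis by simp
qed

text \<open>
  The family \<open>v i a \<otimes> u i a\<close> consists of orthogonal idempotents with sum \<open>\<one>\<close>, and \<open>u i a\<close>, \<open>v i a\<close>
  identify the \<open>(i, a)\<close>-th of them with \<open>e i\<close>.  So the \<open>((i, a), (j, b))\<close> Peirce component of \<open>x\<close>
  becomes \<open>u i a \<otimes> x \<otimes> v j b\<close> in \<open>e i R e j\<close>.
\<close>

lemma block_upper_triangular_iso:
  fixes k :: nat and n :: "nat \<Rightarrow> nat" and e :: "nat \<Rightarrow> 'a" and u v :: "nat \<Rightarrow> nat \<Rightarrow> 'a"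
  defines "T \<equiv> SIGMA i:{1..k}. {1..n i}"
  assumes e: "\<And>i. i \<in> {1..k} \<Longrightarrow> e i \<in> carrier R" "\<And>i. i \<in> {1..k} \<Longrightarrow> e i \<otimes> e i = e i"
    and u: "\<And>i a. (i, a) \<in> T \<Longrightarrow> u i a \<in> carrier R" "\<And>i a. (i, a) \<in> T \<Longrightarrow> e i \<otimes> u i a = u i a"
    and v: "\<And>i a. (i, a) \<in> T \<Longrightarrow> v i a \<in> carrier R" "\<And>i a. (i, a) \<in> T \<Longrightarrow> v i a \<otimes> e i = v i a"
    and uv: "\<And>i a j b. \<lbrakk>(i, a) \<in> T; (j, b) \<in> T\<rbrakk> \<Longrightarrow> u i a \<otimes> v j b = (if i = j \<and> a = b then e i else \<zero>)"
    and sum: "(\<Oplus>p\<in>T. v (fst p) (snd p) \<otimes> u (fst p) (snd p)) = \<one>"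
    and upper: "\<And>i j. \<lbrakk>i \<in> {1..k}; j \<in> {1..k}; j < i\<rbrakk> \<Longrightarrow> peirce R (e i) (e j) = {\<zero>}"
  shows "R \<simeq> block_upper_triangular_ring R k n e"
proof -
  let ?B = "block_upper_triangular_ring R k n e"
  have T: "(i, a) \<in> T \<longleftrightarrow> i \<in> {1..k} \<and> a \<in> {1..n i}" for i a by (auto simp: T_def)
  have fin: "finite T" by (simp add: T_def)
  define \<Phi> where "\<Phi> x i j a b = (if (i, a) \<in> T \<and> (j, b) \<in> T then u i a \<otimes> x \<otimes> v j b else \<zero>)" for x i j a b
  define \<Psi> where "\<Psi> A = (\<Oplus>p\<in>T. \<Oplus>q\<in>T. v (fst p) (snd p) \<otimes> A (fst p) (fst q) (snd p) (snd q) \<otimes> u (fst q) (snd q))"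
    for A :: "nat \<Rightarrow> nat \<Rightarrow> nat \<Rightarrow> nat \<Rightarrow> 'a"
  have uc: "u (fst p) (snd p) \<in> carrier R" "v (fst p) (snd p) \<in> carrier R" if "p \<in> T" for p
    using that u(1) v(1) by auto
  have \<Phi>c: "\<Phi> x i j a b \<in> carrier R" if "x \<in> carrier R" for x i j a b
    using that u(1) v(1) by (auto simp: \<Phi>_def)
  have \<Phi>p: "\<Phi> x i j a b \<in> peirce R (e i) (e j)"
    if "x \<in> carrier R" "(i, a) \<in> T" "(j, b) \<in> T" for x i j a b
  proof -
    have i: "i \<in> {1..k}" and j: "j \<in> {1..k}" using that T by auto
    have "e i \<otimes> (u i a \<otimes> x \<otimes> v j b) = (e i \<otimes> u i a) \<otimes> x \<otimes> v j b"
      using that u(1) v(1) e(1)[OF i] by (simp add: m_assoc)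
    moreover have "(u i a \<otimes> x \<otimes> v j b) \<otimes> e j = u i a \<otimes> x \<otimes> (v j b \<otimes> e j)"
      using that u(1) v(1) e(1)[OF j] by (simp add: m_assoc)
    ultimately show ?thesis
      using that u v e(1)[OF j] peirce_iff[OF e[OF i] e[OF j]] by (simp add: \<Phi>_def)
  qed
  have closed: "\<Phi> x \<in> carrier ?B" if x: "x \<in> carrier R" for x
  proof -
    have "\<Phi> x i j \<in> matrices_over R (n i) (n j) (peirce R (e i) (e j))" if "1 \<le> i \<and> i \<le> j \<and> j \<le> k" for i j
      using that \<Phi>p[OF x] by (auto simp: matrices_over_def T) (auto simp: \<Phi>_def T)
    moreover have "\<Phi> x i j = (\<lambda>a b. \<zero>)" if "\<not> (1 \<le> i \<and> i \<le> j \<and> j \<le> k)" for i j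
    proof (intro ext)
      fix a b
      show "\<Phi> x i j a b = \<zero>"
      proof (cases "(i, a) \<in> T \<and> (j, b) \<in> T")
        case True
        then have "j < i" "i \<in> {1..k}" "j \<in> {1..k}" using that by (auto simp: T)
        then show ?thesis using \<Phi>p[OF x] True upper by blast
      qed (auto simp: \<Phi>_def)
    qed
    ultimately show ?thesis by (auto simp: block_upper_triangular_ring_def)
  qed
  \<comment> \<open>Inserting \<open>\<one>\<close> as the sum of the \<open>v i a \<otimes> u i a\<close>; this turns multiplication in \<open>R\<close> into matrix
    multiplication and recovers \<open>x\<close> from its matrix.\<close>
  have expand: "x \<otimes> y = (\<Oplus>p\<in>T. x \<otimes> v (fst p) (snd p) \<otimes> (u (fst p) (snd p) \<otimes> y))"
    if "x \<in> carrier R" "y \<in> carrier R" for x y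
  proof -
    have "x \<otimes> y = x \<otimes> (\<Oplus>p\<in>T. v (fst p) (snd p) \<otimes> u (fst p) (snd p)) \<otimes> y"
      using that by (simp add: sum)
    also have "\<dots> = (\<Oplus>p\<in>T. x \<otimes> (v (fst p) (snd p) \<otimes> u (fst p) (snd p)) \<otimes> y)"
      using that fin uc by (simp add: finsum_rdistr finsum_ldistr Pi_iff)
    also have "\<dots> = (\<Oplus>p\<in>T. x \<otimes> v (fst p) (snd p) \<otimes> (u (fst p) (snd p) \<otimes> y))"
      using that uc by (intro finsum_cong') (auto simp: m_assoc)
    finally show ?thesis .
  qed
  have mult: "\<Phi> (x \<otimes> y) = \<Phi> x \<otimes>\<^bsub>?B\<^esub> \<Phi> y" if xy: "x \<in> carrier R" "y \<in> carrier R" for x y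
  proof (intro ext)
    fix i j a b
    have "(\<Phi> x \<otimes>\<^bsub>?B\<^esub> \<Phi> y) i j a b = (\<Oplus>l\<in>{1..k}. \<Oplus>c\<in>{1..n l}. \<Phi> x i l a c \<otimes> \<Phi> y l j c b)"
      by (simp add: block_upper_triangular_ring_def)
    also have "\<dots> = (\<Oplus>p\<in>T. \<Phi> x i (fst p) a (snd p) \<otimes> \<Phi> y (fst p) j (snd p) b)"
      unfolding T_def using xy \<Phi>c by (intro finsum_Sigma) auto
    also have "\<dots> = \<Phi> (x \<otimes> y) i j a b"
    proof (cases "(i, a) \<in> T \<and> (j, b) \<in> T")
      case True
      have "(\<Oplus>p\<in>T. \<Phi> x i (fst p) a (snd p) \<otimes> \<Phi> y (fst p) j (snd p) b)
        = (\<Oplus>p\<in>T. (u i a \<otimes> x) \<otimes> v (fst p) (snd p) \<otimes> (u (fst p) (snd p) \<otimes> (y \<otimes> v j b)))"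
        using True xy uc u(1) v(1) by (intro finsum_cong') (auto simp: \<Phi>_def m_assoc)
      also have "\<dots> = (u i a \<otimes> x) \<otimes> (y \<otimes> v j b)"
        using True xy u(1) v(1) by (intro expand[symmetric]) auto
      finally show ?thesis using True xy u(1) v(1) by (simp add: \<Phi>_def m_assoc)
    next
      case False
      then have "(\<Oplus>p\<in>T. \<Phi> x i (fst p) a (snd p) \<otimes> \<Phi> y (fst p) j (snd p) b) = (\<Oplus>p\<in>T. \<zero>)"
        using xy \<Phi>c by (intro finsum_cong') (auto simp: \<Phi>_def u(1) v(1))
      then show ?thesis using False by (auto simp: \<Phi>_def)
    qed
    finally show "\<Phi> (x \<otimes> y) i j a b = (\<Phi> x \<otimes>\<^bsub>?B\<^esub> \<Phi> y) i j a b" by simp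
  qed
  have add: "\<Phi> (x \<oplus> y) = \<Phi> x \<oplus>\<^bsub>?B\<^esub> \<Phi> y" if "x \<in> carrier R" "y \<in> carrier R" for x y
    using that u(1) v(1) by (auto simp: block_upper_triangular_ring_def \<Phi>_def l_distr r_distr intro!: ext)
  have one: "\<Phi> \<one> = \<one>\<^bsub>?B\<^esub>"
    using u(1) v(1) uv by (auto simp: block_upper_triangular_ring_def \<Phi>_def T intro!: ext)
  have entry: "A i j a b \<in> carrier R \<and> e i \<otimes> A i j a b = A i j a b \<and> A i j a b \<otimes> e j = A i j a b"
    if A: "A \<in> carrier ?B" and ij: "(i, a) \<in> T" "(j, b) \<in> T" for A i j a b
  proof -
    have i: "i \<in> {1..k}" and j: "j \<in> {1..k}" using ij T by auto
    have A': "if 1 \<le> i \<and> i \<le> j \<and> j \<le> k then A i j \<in> matrices_over R (n i) (n j) (peirce R (e i) (e j))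
       else A i j = (\<lambda>a b. \<zero>)"
      using A by (simp add: block_upper_triangular_ring_def)
    have "\<zero> \<in> peirce R (e i) (e j)" using e i j by (subst peirce_iff) auto
    then have "A i j a b \<in> peirce R (e i) (e j)"
      using A' ij by (auto simp: matrices_over_def T split: if_splits)
    then show ?thesis using peirce_iff[OF e[OF i] e[OF j]] by simp
  qed
  have outside: "A i j a b = \<zero>" if A: "A \<in> carrier ?B" and ij: "\<not> ((i, a) \<in> T \<and> (j, b) \<in> T)" for A i j a b
  proof -
    have "if 1 \<le> i \<and> i \<le> j \<and> j \<le> k then A i j \<in> matrices_over R (n i) (n j) (peirce R (e i) (e j))
       else A i j = (\<lambda>a b. \<zero>)"
      using A by (simp add: block_upper_triangular_ring_def)
    then show ?thesis using ij by (auto simp: matrices_over_def T split: if_splits)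
  qed
  have term_c: "v (fst p) (snd p) \<otimes> A (fst p) (fst q) (snd p) (snd q) \<otimes> u (fst q) (snd q) \<in> carrier R"
    if "A \<in> carrier ?B" "p \<in> T" "q \<in> T" for A p q
    using that uc entry[OF that(1), of "fst p" "snd p" "fst q" "snd q"] by simp
  have \<Psi>c: "\<Psi> A \<in> carrier R" if "A \<in> carrier ?B" for A
    unfolding \<Psi>_def using term_c[OF that] by (intro finsum_closed Pi_I) auto
  have \<Psi>\<Phi>: "\<Psi> (\<Phi> x) = x" if x: "x \<in> carrier R" for x
  proof -
    have "x = (\<Oplus>p\<in>T. \<one> \<otimes> v (fst p) (snd p) \<otimes> (u (fst p) (snd p) \<otimes> x))"
      using expand[of \<one> x] x by simp
    also have "\<dots> = (\<Oplus>p\<in>T. v (fst p) (snd p) \<otimes> (u (fst p) (snd p) \<otimes> x))"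
      using x uc by (intro finsum_cong') auto
    also have "\<dots> = \<Psi> (\<Phi> x)"
      unfolding \<Psi>_def
    proof (rule finsum_cong')
      fix p assume p: "p \<in> T"
      have "v (fst p) (snd p) \<otimes> (u (fst p) (snd p) \<otimes> x) = (v (fst p) (snd p) \<otimes> (u (fst p) (snd p) \<otimes> x)) \<otimes> \<one>"
        using p uc x by simp
      also have "\<dots> = (\<Oplus>q\<in>T. (v (fst p) (snd p) \<otimes> (u (fst p) (snd p) \<otimes> x)) \<otimes> v (fst q) (snd q) \<otimes> (u (fst q) (snd q) \<otimes> \<one>))"
        using p uc x by (intro expand) auto
      also have "\<dots> = (\<Oplus>q\<in>T. v (fst p) (snd p) \<otimes> \<Phi> x (fst p) (fst q) (snd p) (snd q) \<otimes> u (fst q) (snd q))"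
        using p uc x by (intro finsum_cong') (auto simp: \<Phi>_def m_assoc)
      finally show "v (fst p) (snd p) \<otimes> (u (fst p) (snd p) \<otimes> x) = \<dots>" .
    qed (use uc \<Phi>c x in \<open>auto intro!: finsum_closed\<close>)
    finally show ?thesis by simp
  qed
  have \<Phi>\<Psi>: "\<Phi> (\<Psi> A) = A" if A: "A \<in> carrier ?B" for A
  proof (intro ext)
    fix i j a b
    show "\<Phi> (\<Psi> A) i j a b = A i j a b"
    proof (cases "(i, a) \<in> T \<and> (j, b) \<in> T")
      case True
      then have ia: "(i, a) \<in> T" and jb: "(j, b) \<in> T" by auto
      let ?t = "\<lambda>p q. v (fst p) (snd p) \<otimes> A (fst p) (fst q) (snd p) (snd q) \<otimes> u (fst q) (snd q)"
      have s: "u i a \<otimes> ?t p q \<otimes> v j b = (if p = (i, a) \<and> q = (j, b) then A i j a b else \<zero>)"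
        if p: "p \<in> T" and q: "q \<in> T" for p q
      proof -
        have Ac: "A (fst p) (fst q) (snd p) (snd q) \<in> carrier R"
          using entry[OF A, of "fst p" "snd p" "fst q" "snd q"] p q by simp
        have "u i a \<otimes> ?t p q \<otimes> v j b
          = (u i a \<otimes> v (fst p) (snd p)) \<otimes> A (fst p) (fst q) (snd p) (snd q) \<otimes> (u (fst q) (snd q) \<otimes> v j b)"
          using Ac uc[OF p] uc[OF q] u(1)[OF ia] v(1)[OF jb] by (simp add: m_assoc)
        also have "u i a \<otimes> v (fst p) (snd p) = (if p = (i, a) then e i else \<zero>)"
          using uv[OF ia, of "fst p" "snd p"] p by (auto simp: prod_eq_iff)
        also have "u (fst q) (snd q) \<otimes> v j b = (if q = (j, b) then e j else \<zero>)"
          using uv[OF _ jb, of "fst q" "snd q"] q by (auto simp: prod_eq_iff)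
        finally show ?thesis
          using entry[OF A ia jb] Ac e(1) ia jb by (auto simp: T)
      qed
      have Asum: "(\<Oplus>q\<in>T. ?t p q) \<in> carrier R" if "p \<in> T" for p
        using term_c[OF A that] by (intro finsum_closed Pi_I) auto
      have inner: "u i a \<otimes> (\<Oplus>q\<in>T. ?t p q) \<otimes> v j b = (\<Oplus>q\<in>T. u i a \<otimes> ?t p q \<otimes> v j b)" if p: "p \<in> T" for p
        using term_c[OF A p] fin u(1)[OF ia] v(1)[OF jb]
        by (simp add: finsum_rdistr finsum_ldistr Pi_iff del: m_assoc)
      have "\<Phi> (\<Psi> A) i j a b = u i a \<otimes> (\<Oplus>p\<in>T. \<Oplus>q\<in>T. ?t p q) \<otimes> v j b"
        using True by (simp add: \<Phi>_def \<Psi>_def)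
      also have "\<dots> = (\<Oplus>p\<in>T. u i a \<otimes> (\<Oplus>q\<in>T. ?t p q) \<otimes> v j b)"
        using Asum fin u(1)[OF ia] v(1)[OF jb] by (simp add: finsum_rdistr finsum_ldistr Pi_iff)
      also have "\<dots> = u i a \<otimes> (\<Oplus>q\<in>T. ?t (i, a) q) \<otimes> v j b"
      proof (rule finsum_single[OF fin ia])
        fix p assume p: "p \<in> T" "p \<noteq> (i, a)"
        have "(\<Oplus>q\<in>T. u i a \<otimes> ?t p q \<otimes> v j b) = (\<Oplus>q\<in>T. \<zero>)"
          using s[OF p(1)] p(2) by (intro finsum_cong') auto
        then show "u i a \<otimes> (\<Oplus>q\<in>T. ?t p q) \<otimes> v j b = \<zero>" using inner[OF p(1)] by simp
      qed (use Asum u(1)[OF ia] v(1)[OF jb] in auto)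
      also have "\<dots> = (\<Oplus>q\<in>T. u i a \<otimes> ?t (i, a) q \<otimes> v j b)" by (rule inner[OF ia])
      also have "\<dots> = u i a \<otimes> ?t (i, a) (j, b) \<otimes> v j b"
      proof (rule finsum_single[OF fin jb])
        show "(\<lambda>q. u i a \<otimes> ?t (i, a) q \<otimes> v j b) \<in> T \<rightarrow> carrier R"
          by (rule Pi_I, rule m_closed[OF m_closed[OF u(1)[OF ia] term_c[OF A ia]] v(1)[OF jb]])
        show "u i a \<otimes> ?t (i, a) q \<otimes> v j b = \<zero>" if "q \<in> T" "q \<noteq> (j, b)" for q
          using s[OF ia that(1)] that(2) by simp
      qed
      also have "\<dots> = A i j a b" using s[OF ia jb] by simp
      finally show ?thesis .
    next
      case False
      then show ?thesis using outside[OF A False] by (auto simp: \<Phi>_def)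
    qed
  qed
  have "\<Phi> \<in> ring_iso R ?B"
    unfolding ring_iso_def ring_hom_def
    using closed mult add one \<Psi>c \<Psi>\<Phi> \<Phi>\<Psi>  by (auto intro!: bij_betwI[of _ _ _ \<Psi>])
  then show ?thesis by (auto simp: is_ring_iso_def)
qed

end

section \<open>Indecomposability\<close>

lemma ring_truncate:
  assumes "ring S" shows "ring (ring.truncate S)"
proof -
  interpret ring S by fact
  have "abelian_group (ring.truncate S)"
    by (rule abelian_groupI) (auto simp: ring.defs a_ac intro: l_neg)
  then show ?thesis
    by (rule ringI) (auto simp: ring.defs l_distr r_distr m_assoc intro!: monoidI)
qed

context ring
begin

text \<open>
  A central idempotent \<open>c\<close> splits \<open>R\<close> into the corner rings at \<open>c\<close> and \<open>1 - c\<close>.  They are truncated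
  because the factors of a product decomposition are plain rings, without the record extension of \<open>R\<close>.
\<close>

lemma indecomposable_central_idempotent:
  assumes ind: "indecomposable_ring R" and c: "c \<in> carrier R" "c \<otimes> c = c"
    and central: "\<And>x. x \<in> carrier R \<Longrightarrow> c \<otimes> x = x \<otimes> c"
  shows "c = \<zero> \<or> c = \<one>"
proof (rule ccontr)
  assume ne: "\<not> ?thesis"
  let ?d = "\<one> \<ominus> c"
  have d: "?d \<in> carrier R" "?d \<otimes> ?d = ?d" "?d \<otimes> c = \<zero>" "c \<otimes> ?d = \<zero>" "c \<oplus> ?d = \<one>"
  proof -
    show "?d \<in> carrier R" using c by simp
    show dc: "?d \<otimes> c = \<zero>" "c \<otimes> ?d = \<zero>"
      using c by (simp_all add: minus_eq l_distr r_distr l_minus r_minus r_neg)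
    have "?d \<otimes> ?d = ?d \<otimes> \<one> \<ominus> ?d \<otimes> c"
      using c by (simp only: minus_eq r_distr r_minus one_closed a_inv_closed a_closed)
    then show "?d \<otimes> ?d = ?d" unfolding dc(1) using c by (simp add: minus_eq)
    have "c \<oplus> ?d = \<one> \<oplus> (c \<oplus> \<ominus> c)" unfolding minus_eq using c by (intro a_lcomm) auto
    then show "c \<oplus> ?d = \<one>" using c by (simp add: r_neg)
  qed
  have dcentral: "?d \<otimes> x = x \<otimes> ?d" if "x \<in> carrier R" for x
    using that c(1) central[OF that] by (simp add: minus_eq l_distr r_distr l_minus r_minus)
  have d0: "?d \<noteq> \<zero>" using ne c(1) by (metis one_closed r_right_minus_eq)
  let ?S = "ring.truncate (corner_ring R c)" and ?T = "ring.truncate (corner_ring R ?d)"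
  have rings: "ring ?S" "ring ?T"
    using c d by (auto intro!: ring_truncate corner_ring_ring)
  have car: "x \<in> carrier ?S \<longleftrightarrow> x \<in> carrier R \<and> c \<otimes> x = x" "x \<in> carrier ?T \<longleftrightarrow> x \<in> carrier R \<and> ?d \<otimes> x = x" for x
    using peirce_iff[OF c c, of x] peirce_iff[OF d(1,2) d(1,2), of x] central[of x] dcentral[of x]
    by (auto simp: ring.defs corner_ring_def)
  have nz: "carrier ?S \<noteq> {\<zero>\<^bsub>?S\<^esub>}" "carrier ?T \<noteq> {\<zero>\<^bsub>?T\<^esub>}"
  proof -
    have "c \<in> carrier ?S" "?d \<in> carrier ?T" using c d by (auto simp: car)
    moreover have "\<zero>\<^bsub>?S\<^esub> = \<zero>" "\<zero>\<^bsub>?T\<^esub> = \<zero>" by (auto simp: ring.defs corner_ring_def)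
    ultimately show "carrier ?S \<noteq> {\<zero>\<^bsub>?S\<^esub>}" "carrier ?T \<noteq> {\<zero>\<^bsub>?T\<^esub>}" using ne d0 by auto
  qed
  let ?h = "\<lambda>x. (c \<otimes> x, ?d \<otimes> x)"
  have "?h \<in> ring_iso R (RDirProd ?S ?T)"
  proof -
    have mem: "c \<otimes> x \<in> carrier ?S" "?d \<otimes> x \<in> carrier ?T" if "x \<in> carrier R" for x
      using that c d by (auto simp: car simp flip: m_assoc)
    have mult: "c \<otimes> (x \<otimes> y) = (c \<otimes> x) \<otimes> (c \<otimes> y)" "?d \<otimes> (x \<otimes> y) = (?d \<otimes> x) \<otimes> (?d \<otimes> y)"
      if "x \<in> carrier R" "y \<in> carrier R" for x y
    proof -
      have "(c \<otimes> x) \<otimes> (c \<otimes> y) = c \<otimes> (x \<otimes> c) \<otimes> y" using that c(1) by (simp add: m_assoc)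
      also have "\<dots> = c \<otimes> (c \<otimes> x) \<otimes> y" by (simp only: central[OF that(1)])
      also have "\<dots> = (c \<otimes> c) \<otimes> (x \<otimes> y)" using that c(1) by (simp add: m_assoc)
      finally show "c \<otimes> (x \<otimes> y) = (c \<otimes> x) \<otimes> (c \<otimes> y)" using c(2) by simp
      have "(?d \<otimes> x) \<otimes> (?d \<otimes> y) = ?d \<otimes> (x \<otimes> ?d) \<otimes> y" using that d(1) by (simp add: m_assoc)
      also have "\<dots> = ?d \<otimes> (?d \<otimes> x) \<otimes> y" by (simp only: dcentral[OF that(1)])
      also have "\<dots> = (?d \<otimes> ?d) \<otimes> (x \<otimes> y)" using that d(1) by (simp add: m_assoc)
      finally show "?d \<otimes> (x \<otimes> y) = (?d \<otimes> x) \<otimes> (?d \<otimes> y)" using d(2) by simp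
    qed
    have sum: "c \<otimes> x \<oplus> ?d \<otimes> x = x" if "x \<in> carrier R" for x
      using that c d by (simp flip: l_distr)
    have "bij_betw ?h (carrier R) (carrier ?S \<times> carrier ?T)"
    proof (rule bij_betwI[of _ _ _ "\<lambda>(x, y). x \<oplus> y"])
      fix p assume "p \<in> carrier ?S \<times> carrier ?T"
      then obtain x y where p: "p = (x, y)" "x \<in> carrier R" "c \<otimes> x = x" "y \<in> carrier R" "?d \<otimes> y = y"
        by (auto simp: car)
      have "c \<otimes> y = (c \<otimes> ?d) \<otimes> y" using p c d(1) by (simp add: m_assoc)
      then have cy: "c \<otimes> y = \<zero>" using d p by simp
      have "?d \<otimes> x = (?d \<otimes> c) \<otimes> x" using p c d(1) by (simp add: m_assoc)
      then have dx: "?d \<otimes> x = \<zero>" using d p by simp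
      show "?h (case p of (x, y) \<Rightarrow> x \<oplus> y) = p"
        using p c(1) d(1) cy dx by (simp add: r_distr)
    qed (use mem sum in \<open>auto simp: car\<close>)
    then show ?thesis
      using mem mult c d
      by (auto simp: ring_iso_def ring_hom_def RDirProd_carrier)
        (auto simp: RDirProd_def DirProd_def monoid.defs ring.defs corner_ring_def r_distr)
  qed
  then have "R \<simeq> RDirProd ?S ?T" by (auto simp: is_ring_iso_def)
  then show False using ind rings nz unfolding indecomposable_ring_def by blast
qed

lemma sum_orthogonal_mult:
  assumes "finite F" "C \<subseteq> F" "F \<subseteq> carrier R" "f \<in> F"
    and "\<And>e. e \<in> F \<Longrightarrow> e \<otimes> e = e" "\<And>e e'. \<lbrakk>e \<in> F; e' \<in> F; e \<noteq> e'\<rbrakk> \<Longrightarrow> e \<otimes> e' = \<zero>"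
  shows "(\<Oplus>e\<in>C. e) \<otimes> f = (if f \<in> C then f else \<zero>)"
proof -
  have fin: "finite C" and C: "(\<lambda>e. e) \<in> C \<rightarrow> carrier R" and f: "f \<in> carrier R"
    using assms finite_subset by auto
  have "(\<Oplus>e\<in>C. e) \<otimes> f = (\<Oplus>e\<in>C. e \<otimes> f)" using finsum_ldistr[OF fin f C] .
  also have "\<dots> = (if f \<in> C then f else \<zero>)"
  proof (cases "f \<in> C")
    case True
    have "(\<Oplus>e\<in>C. e \<otimes> f) = f \<otimes> f"
      by (rule finsum_single[OF fin True]) (use assms in auto)
    then show ?thesis using True assms by simp
  next
    case False
    have "e \<otimes> f = \<zero>" if "e \<in> C" for e using assms(2,4) assms(6)[of e f] that False by blast
    then have "(\<Oplus>e\<in>C. e \<otimes> f) = (\<Oplus>e\<in>C. \<zero>)" by (intro finsum_cong') auto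
    then show ?thesis using False by simp
  qed
  finally show ?thesis .
qed

lemma sum_peirce_zero:
  assumes "finite A" "finite B" "A \<subseteq> carrier R" "B \<subseteq> carrier R" "x \<in> carrier R"
    and "\<And>e f. \<lbrakk>e \<in> A; f \<in> B\<rbrakk> \<Longrightarrow> e \<otimes> x \<otimes> f = \<zero>"
  shows "(\<Oplus>e\<in>A. e) \<otimes> x \<otimes> (\<Oplus>f\<in>B. f) = \<zero>"
proof -
  have A: "(\<Oplus>e\<in>A. e) \<in> carrier R" and B: "(\<Oplus>f\<in>B. f) \<in> carrier R"
    using assms by (auto intro!: finsum_closed)
  have "e \<otimes> (x \<otimes> (\<Oplus>f\<in>B. f)) = \<zero>" if e: "e \<in> A" for e
  proof -
    have "e \<otimes> x \<otimes> (\<Oplus>f\<in>B. f) = (\<Oplus>f\<in>B. e \<otimes> x \<otimes> f)"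
      by (rule finsum_rdistr) (use assms e in auto)
    also have "\<dots> = (\<Oplus>f\<in>B. \<zero>)" by (rule finsum_cong') (use assms e in auto)
    finally show ?thesis using assms(3,5) B e by (simp add: m_assoc subset_iff)
  qed
  then have "(\<Oplus>e\<in>A. e \<otimes> (x \<otimes> (\<Oplus>f\<in>B. f))) = (\<Oplus>e\<in>A. \<zero>)"
    by (intro finsum_cong') auto
  then show ?thesis
    using assms A B finsum_ldistr[of A "x \<otimes> (\<Oplus>f\<in>B. f)" "\<lambda>e. e"]
    by (simp add: m_assoc Pi_iff subset_iff)
qed

text \<open>
  If no Peirce component joins \<open>C\<close> to its complement, then the sum \<open>c\<close> of \<open>C\<close> satisfies
  \<open>c x (1 - c) = 0 = (1 - c) x c\<close> for all \<open>x\<close>.  So it is central, and indecomposability makes it \<open>0\<close> or \<open>1\<close>.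
  It is not \<open>0\<close>, since \<open>c e = e\<close> for \<open>e \<in> C\<close>, and \<open>c = 1\<close> would give \<open>f = c f = 0\<close> for \<open>f \<in> F - C\<close>.
\<close>

lemma indecomposable_connected:
  assumes ind: "indecomposable_ring R" and F: "finite F" "F \<subseteq> carrier R" "(\<Oplus>e\<in>F. e) = \<one>"
    and idem: "\<And>e. e \<in> F \<Longrightarrow> e \<otimes> e = e \<and> e \<noteq> \<zero>"
    and orth: "\<And>e e'. \<lbrakk>e \<in> F; e' \<in> F; e \<noteq> e'\<rbrakk> \<Longrightarrow> e \<otimes> e' = \<zero>"
    and C: "C \<subseteq> F" "C \<noteq> {}"
    and sep: "\<And>e f. \<lbrakk>e \<in> C; f \<in> F - C\<rbrakk> \<Longrightarrow> peirce R e f = {\<zero>} \<and> peirce R f e = {\<zero>}"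
  shows "C = F"
proof (rule ccontr)
  assume "C \<noteq> F"
  then obtain f where f: "f \<in> F" "f \<notin> C" using C by auto
  obtain e where e: "e \<in> C" using C by auto
  let ?c = "\<Oplus>e\<in>C. e" and ?d = "\<Oplus>e\<in>F - C. e"
  have fin: "finite C" "finite (F - C)" "C \<subseteq> carrier R" "F - C \<subseteq> carrier R"
    using F C finite_subset by auto
  have cd: "?c \<in> carrier R" "?d \<in> carrier R" using fin by (auto intro!: finsum_closed)
  have "?c \<oplus> ?d = (\<Oplus>e\<in>C \<union> (F - C). e)"
    by (rule finsum_Un_disjoint[symmetric]) (use fin in auto)
  also have "C \<union> (F - C) = F" using C by auto
  finally have cd1: "?c \<oplus> ?d = \<one>" using F by simp
  have mult0: "e \<otimes> x \<otimes> f = \<zero>" "f \<otimes> x \<otimes> e = \<zero>" if "e \<in> C" "f \<in> F - C" "x \<in> carrier R" for e f x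
    using sep[OF that(1,2)] that(3) by (auto simp: peirce_def)
  have cxd: "?c \<otimes> x \<otimes> ?d = \<zero>" "?d \<otimes> x \<otimes> ?c = \<zero>" if "x \<in> carrier R" for x
    using sum_peirce_zero[OF fin that] sum_peirce_zero[OF fin(2,1,4,3) that] mult0 that by auto
  have l: "?c \<otimes> x = ?c \<otimes> x \<otimes> ?c" if x: "x \<in> carrier R" for x
  proof -
    have "?c \<otimes> x = ?c \<otimes> x \<otimes> (?c \<oplus> ?d)" unfolding cd1 using cd x by simp
    also have "\<dots> = ?c \<otimes> x \<otimes> ?c"
      using r_distr[OF cd m_closed[OF cd(1) x]] cxd(1)[OF x] cd x by (metis m_closed r_zero)
    finally show ?thesis .
  qed
  have r: "x \<otimes> ?c = ?c \<otimes> x \<otimes> ?c" if x: "x \<in> carrier R" for x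
  proof -
    have "x \<otimes> ?c = (?c \<oplus> ?d) \<otimes> x \<otimes> ?c" unfolding cd1 using cd x by simp
    also have "\<dots> = ?c \<otimes> x \<otimes> ?c"
      using l_distr[OF cd x] l_distr[of "?c \<otimes> x" "?d \<otimes> x" ?c] cxd(2)[OF x] cd x by (metis m_closed r_zero)
    finally show ?thesis .
  qed
  have "?c \<otimes> ?c = ?c" using l[OF one_closed] cd by simp
  moreover have "?c \<otimes> x = x \<otimes> ?c" if "x \<in> carrier R" for x using l[OF that] r[OF that] by simp
  ultimately have "?c = \<zero> \<or> ?c = \<one>" by (rule indecomposable_central_idempotent[OF ind cd(1)])
  moreover have "?c \<otimes> e = e" "?c \<otimes> f = \<zero>"
    using sum_orthogonal_mult[OF F(1) C(1) F(2)] idem orth e f C by auto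
  moreover have "e \<in> carrier R" "f \<in> carrier R" "e \<noteq> \<zero>" "f \<noteq> \<zero>"
    using e f C(1) idem F(2) by auto
  ultimately show False by auto
qed

section \<open>The structure theorem\<close>

text \<open>
  Sorting representatives \<open>f\<close> of the isomorphism classes by the number of \<open>g\<close> with \<open>g R f \<noteq> 0\<close>
  makes the matrices triangular: \<open>e R f \<noteq> 0\<close> implies that each \<open>g\<close> counted for \<open>e\<close> is counted for
  \<open>f\<close>, and then equal counts force \<open>f R e \<noteq> 0\<close>.
\<close>

lemma block_triangular_decomposition:
  assumes ra: "right_artinian R" and ns: "right_nonsingular R" and ne: "\<one> \<noteq> \<zero>"
    and F: "finite F" "(\<Oplus>e\<in>F. e) = \<one>" "\<And>e. e \<in> F \<Longrightarrow> uniform_idempotent R e"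
    and orth: "\<And>e e'. \<lbrakk>e \<in> F; e' \<in> F; e \<noteq> e'\<rbrakk> \<Longrightarrow> e \<otimes> e' = \<zero>"
  shows "\<exists>k n e. 0 < k \<and> (\<forall>i\<in>{1..k}. 0 < n i \<and> e i \<in> F) \<and> R \<simeq> block_upper_triangular_ring R k n e"
proof -
  have Fc: "e \<in> carrier R" "e \<otimes> e = e" "e \<noteq> \<zero>" if "e \<in> F" for e
    using uniform_idempotentD[OF F(3)[OF that]] by auto
  define le where "le e f \<longleftrightarrow> peirce R e f \<noteq> {\<zero>}" for e f
  have zero_in: "\<zero> \<in> peirce R e f" if "e \<in> F" "f \<in> F" for e f
    using uniform_peirce_iff[OF F(3) F(3)] Fc that by simp
  have le_iff: "le e f \<longleftrightarrow> (\<exists>a\<in>peirce R e f. a \<noteq> \<zero>)" if "e \<in> F" "f \<in> F" for e f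
    using zero_in[OF that] unfolding le_def by blast
  have refl: "le e e" if "e \<in> F" for e
    using le_iff[OF that that] uniform_peirce_iff[OF F(3) F(3)] Fc that by blast
  have trans: "le e g" if efg: "e \<in> F" "f \<in> F" "g \<in> F" and l: "le e f" "le f g" for e f g
  proof -
    obtain a b where "a \<in> peirce R e f" "a \<noteq> \<zero>" "b \<in> peirce R f g" "b \<noteq> \<zero>"
      using l efg by (auto simp: le_iff)
    then have "a \<otimes> b \<in> peirce R e g" "a \<otimes> b \<noteq> \<zero>"
      using peirce_mult_closed[OF F(3)[OF efg(1)] F(3)[OF efg(2)] F(3)[OF efg(3)]]
        peirce_mult_nonzero[OF ns F(3)[OF efg(1)] F(3)[OF efg(2)] F(3)[OF efg(3)]] by auto
    then show ?thesis using le_iff[OF efg(1,3)] by blast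
  qed
  define eqv where "eqv e f \<longleftrightarrow> le e f \<and> le f e" for e f
  define rep where "rep e = (SOME g. g \<in> F \<and> eqv g e)" for e
  have rep: "rep e \<in> F \<and> eqv (rep e) e" if "e \<in> F" for e
    unfolding rep_def by (rule someI[of _ e]) (use that refl in \<open>auto simp: eqv_def\<close>)
  have rep_eq: "rep e = rep f" if "e \<in> F" "f \<in> F" "eqv e f" for e f
  proof -
    have "(g \<in> F \<and> eqv g e) = (g \<in> F \<and> eqv g f)" for g
      using that trans unfolding eqv_def by blast
    then show ?thesis by (simp add: rep_def)
  qed
  have rep_rep: "rep (rep e) = rep e" if "e \<in> F" for e
    using rep[OF that] that by (intro rep_eq) auto
  define r where "r e = card {g \<in> F. le g e}" for e
  have sub: "{g \<in> F. le g e} \<subseteq> {g \<in> F. le g f}" if "e \<in> F" "f \<in> F" "le e f" for e f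
    using that trans by blast
  have r_mono: "r e \<le> r f" if "e \<in> F" "f \<in> F" "le e f" for e f
    unfolding r_def using F(1) sub[OF that] by (intro card_mono) auto
  have r_eq: "le f e" if "e \<in> F" "f \<in> F" "le e f" "r e = r f" for e f
  proof -
    have "{g \<in> F. le g e} = {g \<in> F. le g f}"
      using card_subset_eq[OF _ sub[OF that(1-3)]] that(4) F(1) by (simp add: r_def)
    then show ?thesis using that(2) refl by blast
  qed
  obtain xs0 where xs0: "set xs0 = rep ` F" "distinct xs0"
    using finite_distinct_list[OF finite_imageI[OF F(1), of rep]] by auto
  define xs where "xs = sort_key r xs0"
  have xs: "set xs = rep ` F" "distinct xs" "sorted (map r xs)" using xs0 by (auto simp: xs_def)
  define k where "k = length xs"
  \<comment> \<open>Lists are indexed from \<open>0\<close>, blocks from \<open>1\<close>.\<close>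
  define e where "e i = xs ! (i - 1)" for i
  have eset: "e ` {1..k} = rep ` F"
  proof -
    have "e ` {1..k} = (\<lambda>i. xs ! i) ` {..<k}"
    proof (intro equalityI subsetI)
      fix y assume "y \<in> (\<lambda>i. xs ! i) ` {..<k}"
      then obtain i where "i < k" "y = xs ! i" by auto
      then show "y \<in> e ` {1..k}" by (intro image_eqI[of _ _ "Suc i"]) (auto simp: e_def)
    qed (auto simp: e_def)
    then show ?thesis using xs(1) by (auto simp: k_def set_conv_nth)
  qed
  have einj: "i = j" if "i \<in> {1..k}" "j \<in> {1..k}" "e i = e j" for i j
  proof -
    have "i - 1 < length xs" "j - 1 < length xs" using that by (auto simp: k_def)
    then have "i - 1 = j - 1" using nth_eq_iff_index_eq[OF xs(2)] that(3) by (simp add: e_def)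
    then show ?thesis using that(1,2) by auto
  qed
  have eF: "e i \<in> F" "rep (e i) = e i" if "i \<in> {1..k}" for i
  proof -
    have "e i \<in> rep ` F" unfolding eset[symmetric] using that by (rule imageI)
    then obtain f where "f \<in> F" "e i = rep f" by auto
    then show "e i \<in> F" "rep (e i) = e i" using rep rep_rep by auto
  qed
  have upper: "peirce R (e i) (e j) = {\<zero>}" if ij: "i \<in> {1..k}" "j \<in> {1..k}" "j < i" for i j
  proof (rule ccontr)
    assume "peirce R (e i) (e j) \<noteq> {\<zero>}"
    then have l: "le (e i) (e j)" by (simp add: le_def)
    have "r (e j) \<le> r (e i)"
      using sorted_nth_mono[OF xs(3), of "j - 1" "i - 1"] ij by (auto simp: e_def k_def)
    then have "r (e i) = r (e j)"
      using r_mono[OF eF(1)[OF ij(1)] eF(1)[OF ij(2)] l] by simp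
    then have "le (e j) (e i)" using r_eq[OF eF(1)[OF ij(1)] eF(1)[OF ij(2)] l] by simp
    then have "rep (e i) = rep (e j)" using l eF ij by (intro rep_eq) (auto simp: eqv_def)
    then have "e i = e j" using eF(2)[OF ij(1)] eF(2)[OF ij(2)] by simp
    then show False using einj[OF ij(1,2)] ij(3) by simp
  qed
  define C where "C i = {f \<in> F. rep f = e i}" for i
  define n where "n i = card (C i)" for i
  have finC: "finite (C i)" for i using F(1) by (simp add: C_def)
  have eC: "e i \<in> C i" if "i \<in> {1..k}" for i using eF that by (simp add: C_def)
  have n0: "0 < n i" if "i \<in> {1..k}" for i
    using eC[OF that] finC[of i] by (auto simp: n_def card_gt_0_iff)
  have "\<exists>h. bij_betw h {1..n i} (C i)" for i
    using ex_bij_betw_nat_finite_1[OF finC] by (simp add: n_def)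
  then obtain h where h: "\<And>i. bij_betw (h i) {1..n i} (C i)" by metis
  define T where "T = (SIGMA i:{1..k}. {1..n i})"
  have T: "(i, a) \<in> T \<longleftrightarrow> i \<in> {1..k} \<and> a \<in> {1..n i}" for i a by (auto simp: T_def)
  have hC: "h i a \<in> F" "rep (h i a) = e i" if "(i, a) \<in> T" for i a
    using bij_betw_apply[OF h, of a i] that by (auto simp: T C_def)
  have hinj: "i = j \<and> a = b" if "(i, a) \<in> T" "(j, b) \<in> T" "h i a = h j b" for i a j b
  proof -
    have "e i = e j" using hC that by metis
    then have "i = j" using einj that by (auto simp: T)
    then show ?thesis using that bij_betw_imp_inj_on[OF h[of i]] by (auto simp: T dest: inj_onD)
  qed
  have "\<exists>u v. u \<in> peirce R (e i) (h i a) \<and> v \<in> peirce R (h i a) (e i) \<and> u \<otimes> v = e i \<and> v \<otimes> u = h i a"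
    if ia: "(i, a) \<in> T" for i a
  proof -
    have "eqv (e i) (h i a)" using rep hC[OF ia] by metis
    then have "peirce R (e i) (h i a) \<noteq> {\<zero>}" "peirce R (h i a) (e i) \<noteq> {\<zero>}" by (auto simp: eqv_def le_def)
    then show ?thesis
      using uniform_peirce_mutual[OF ra ns F(3) F(3), of "e i" "h i a"] hC[OF ia] eF ia by (auto simp: T)
  qed
  then obtain u v where uv: "\<And>i a. (i, a) \<in> T \<Longrightarrow>
      u i a \<in> peirce R (e i) (h i a) \<and> v i a \<in> peirce R (h i a) (e i) \<and> u i a \<otimes> v i a = e i \<and> v i a \<otimes> u i a = h i a"
    by metis
  have u: "u i a \<in> carrier R \<and> e i \<otimes> u i a = u i a \<and> u i a \<otimes> h i a = u i a" if "(i, a) \<in> T" for i a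
    using uv[OF that] uniform_peirce_iff[OF F(3) F(3), of "e i" "h i a"] hC[OF that] eF that by (auto simp: T)
  have v: "v i a \<in> carrier R \<and> h i a \<otimes> v i a = v i a \<and> v i a \<otimes> e i = v i a" if "(i, a) \<in> T" for i a
    using uv[OF that] uniform_peirce_iff[OF F(3) F(3), of "h i a" "e i"] hC[OF that] eF that by (auto simp: T)
  have "R \<simeq> block_upper_triangular_ring R k n e"
  proof (rule block_upper_triangular_iso[of k e n u v])
    fix i a j b assume ia: "(i, a) \<in> (SIGMA i:{1..k}. {1..n i})" and jb: "(j, b) \<in> (SIGMA i:{1..k}. {1..n i})"
    note ia' = ia[folded T_def] and jb' = jb[folded T_def]
    show "u i a \<otimes> v j b = (if i = j \<and> a = b then e i else \<zero>)"
    proof (cases "i = j \<and> a = b")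
      case False
      then have "h i a \<noteq> h j b" using hinj ia' jb' by blast
      then have o: "h i a \<otimes> h j b = \<zero>" using orth hC ia' jb' by auto
      have "u i a \<otimes> v j b = (u i a \<otimes> h i a) \<otimes> (h j b \<otimes> v j b)" using u[OF ia'] v[OF jb'] by simp
      also have "\<dots> = u i a \<otimes> (h i a \<otimes> h j b) \<otimes> v j b"
        using u[OF ia', THEN conjunct1] v[OF jb', THEN conjunct1] Fc(1)[OF hC(1)[OF ia']] Fc(1)[OF hC(1)[OF jb']]
        by (simp add: m_assoc)
      also have "\<dots> = \<zero>" using o u[OF ia'] v[OF jb'] by simp
      finally show ?thesis using False by auto
    qed (use uv ia' in auto)
  next
    have "(\<Oplus>p\<in>T. v (fst p) (snd p) \<otimes> u (fst p) (snd p)) = (\<Oplus>p\<in>T. h (fst p) (snd p))"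
      using uv hC Fc by (intro finsum_cong') auto
    also have "\<dots> = (\<Oplus>f\<in>(\<lambda>p. h (fst p) (snd p)) ` T. f)"
      using hinj hC Fc by (intro add.finprod_reindex[symmetric]) (auto intro!: inj_onI)
    also have "(\<lambda>p. h (fst p) (snd p)) ` T = F"
    proof (intro equalityI subsetI)
      fix f assume f: "f \<in> F"
      then obtain i where i: "i \<in> {1..k}" "rep f = e i" using eset by (metis imageE imageI)
      then have "f \<in> h i ` {1..n i}" using bij_betw_imp_surj_on[OF h[of i]] f by (simp add: C_def)
      then obtain a where "a \<in> {1..n i}" "f = h i a" by auto
      then show "f \<in> (\<lambda>p. h (fst p) (snd p)) ` T" using i
        by (intro image_eqI[of _ _ "(i, a)"]) (auto simp: T)
    qed (use hC in auto)
    finally show "(\<Oplus>p\<in>(SIGMA i:{1..k}. {1..n i}). v (fst p) (snd p) \<otimes> u (fst p) (snd p)) = \<one>"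
      using F(2) by (simp add: T_def)
  next
    fix i a assume "(i, a) \<in> (SIGMA i:{1..k}. {1..n i})"
    then have "(i, a) \<in> T" by (simp add: T_def)
    then show "u i a \<in> carrier R" "e i \<otimes> u i a = u i a" "v i a \<in> carrier R" "v i a \<otimes> e i = v i a"
      using u v by auto
  qed (use eF Fc upper in auto)
  moreover have "0 < k"
  proof -
    have "F \<noteq> {}" using F(2) ne by auto
    then show ?thesis using eset by (cases "k = 0") auto
  qed
  ultimately show ?thesis using n0 eF by (intro exI[of _ k] exI[of _ n] exI[of _ e]) auto
qed

end

theorem theorem5p6:
  fixes R :: "('a, 'r) ring_scheme"
  assumes "ring R"
    and "\<one>\<^bsub>R\<^esub> \<noteq> \<zero>\<^bsub>R\<^esub>"
    and "indecomposable_ring R"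
    and "right_artinian R"
    and "right_nonsingular R"
    and "right_weak_CS R"
    and "right_a_ring TYPE('e) R"
  shows "\<exists>(k :: nat) (n :: nat \<Rightarrow> nat) (e :: nat \<Rightarrow> 'a).
    0 < k \<and> (\<forall>i\<in>{1..k}. 0 < n i) \<and>
    (\<forall>i\<in>{1..k}. e i \<in> carrier R \<and> e i \<otimes>\<^bsub>R\<^esub> e i = e i) \<and>
    R \<simeq> block_upper_triangular_ring R k n e \<and>
    (\<forall>i\<in>{1..k}. is_division_ring (corner_ring R (e i))) \<and>
    (\<forall>i\<in>{1..k}. \<forall>j\<in>{1..k}. corner_ring R (e i) \<simeq> corner_ring R (e j)) \<and>
    (\<forall>i\<in>{1..k}. \<forall>j\<in>{1..k}. peirce R (e i) (e j) \<noteq> {\<zero>\<^bsub>R\<^esub>} \<longrightarrow>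
       peirce_left_dim R (e i) (e j) 1 \<and> peirce_right_dim R (e i) (e j) 1)"
proof -
  interpret ring R by fact
  obtain F where F: "finite F" "\<And>e. e \<in> F \<Longrightarrow> uniform_idempotent R e"
    "\<And>e e'. \<lbrakk>e \<in> F; e' \<in> F; e \<noteq> e'\<rbrakk> \<Longrightarrow> e \<otimes>\<^bsub>R\<^esub> e' = \<zero>\<^bsub>R\<^esub>" "(\<Oplus>\<^bsub>R\<^esub>e\<in>F. e) = \<one>\<^bsub>R\<^esub>"
    using uniform_decomposition[OF assms(4-6) one_closed] by auto
  note Fc = uniform_idempotentD[OF F(2)]
  obtain k n e where k: "0 < k" "R \<simeq> block_upper_triangular_ring R k n e"
    and e: "\<And>i. i \<in> {1..k} \<Longrightarrow> 0 < n i \<and> e i \<in> F"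
    using block_triangular_decomposition[OF assms(4,5,2) F(1,4,2,3)] by blast
  have rings: "ring (corner_ring R f)" if "f \<in> F" for f
    using Fc that by (intro corner_ring_ring) auto
  have iso: "corner_ring R f \<simeq> corner_ring R g" if f: "f \<in> F" and g: "g \<in> F" for f g
  proof -
    let ?C = "{g \<in> F. corner_ring R f \<simeq> corner_ring R g}"
    have sep: "peirce R g h = {\<zero>\<^bsub>R\<^esub>} \<and> peirce R h g = {\<zero>\<^bsub>R\<^esub>}" if gh: "g \<in> ?C" "h \<in> F - ?C" for g h
    proof (rule ccontr)
      assume "\<not> ?thesis"
      then have "corner_ring R g \<simeq> corner_ring R h"
        using corner_ring_iso[OF assms(5,7) F(2) F(2)] ring_iso_sym[OF rings] gh by blast
      then show False using gh ring_iso_trans by blast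
    qed
    have "corner_ring R f \<simeq> corner_ring R f"
      by (auto simp: is_ring_iso_def ring_iso_def ring_hom_def intro!: exI[of _ id])
    then have "?C = F"
      using Fc F f sep by (intro indecomposable_connected[OF assms(3)]) auto
    then show ?thesis using g by blast
  qed
  show ?thesis
  proof (intro exI[of _ k] exI[of _ n] exI[of _ e] conjI ballI impI)
    fix i j assume "i \<in> {1..k}" "j \<in> {1..k}" "peirce R (e i) (e j) \<noteq> {\<zero>\<^bsub>R\<^esub>}"
    then show "peirce_left_dim R (e i) (e j) 1" "peirce_right_dim R (e i) (e j) 1"
      using peirce_dims[OF assms(5,7) F(2) F(2)] e by auto
  next
    fix i assume "i \<in> {1..k}"
    then show "is_division_ring (corner_ring R (e i))"
      using corner_is_division_ring[OF assms(4,5) F(2)] e by auto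
  qed (use k e Fc iso in auto)
qed

end
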